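(* Let $A$ be a separable unital $C^*$-algebra and $\alpha$ an automorphism of $A$. Let $T_\alpha$ be the homeomorphism $\sigma\mapsto\sigma\circ\alpha$ of the state space $S(A)$ with the weak$^*$ topology. Then either $h_{\mathrm{top}}(T_\alpha)=0$ or $h_{\mathrm{top}}(T_\alpha)=\infty$.
   Context: $S(A)$ is the set of positive linear functionals $\phi$ on $A$ with $\phi(1)=1$. Topological entropy: for a homeomorphism $T$ of a compact metrizable space $X$ and a finite open cover $\mathcal U$ of $X$, let $N(\mathcal U)$ be the smallest cardinality of a subcover, $h_{\mathrm{top}}(T,\mathcal U)=\lim_{n\to\infty}\frac1n\log N(\mathcal U\vee T^{-1}\mathcal U\vee\cdots\vee T^{-(n-1)}\mathcal U)$, and $h_{\mathrm{top}}(T)=\sup_{\mathcal U}h_{\mathrm{top}}(T,\mathcal U)$ over all finite open covers. *)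

theory Defs
  imports "HOL-Analysis.Analysis"
begin

section \<open>Unital $C^*$-algebras\<close>

text \<open>
  The library has no class of complex algebras, so complex scalar multiplication is added to
  the real class and required to extend \<open>scaleR\<close>. The class \<open>real_normed_algebra_1\<close>
  excludes the zero algebra (whose state space is empty); its axiom \<open>norm 1 = 1\<close> is no
  further restriction, as it follows from the $C^*$-identity once \<open>1 \<noteq> 0\<close>.
\<close>

class cstar_algebra_1 = real_normed_algebra_1 + banach +
  fixes scaleC :: "complex \<Rightarrow> 'a \<Rightarrow> 'a"  (infixr \<open>*\<^sub>C\<close> 75)
    and star :: "'a \<Rightarrow> 'a"
  assumes scaleC_of_real: "scaleC (complex_of_real r) x = scaleR r x"
    and scaleC_add_right: "scaleC c (x + y) = scaleC c x + scaleC c y"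
    and scaleC_add_left: "scaleC (c + d) x = scaleC c x + scaleC d x"
    and scaleC_scaleC: "scaleC c (scaleC d x) = scaleC (c * d) x"
    and mult_scaleC_left: "scaleC c x * y = scaleC c (x * y)"
    and mult_scaleC_right: "x * scaleC c y = scaleC c (x * y)"
    and norm_scaleC: "norm (scaleC c x) = cmod c * norm x"
    and star_star: "star (star x) = x"
    and star_add: "star (x + y) = star x + star y"
    and star_scaleC: "star (scaleC c x) = scaleC (cnj c) (star x)"
    and star_mult: "star (x * y) = star y * star x"
    and cstar_identity: "norm (star x * x) = (norm x)\<^sup>2"

definition cstar_automorphism :: "('a::cstar_algebra_1 \<Rightarrow> 'a) \<Rightarrow> bool" where
  "cstar_automorphism \<alpha> \<longleftrightarrow>
     bij \<alpha> \<and>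
     (\<forall>x y. \<alpha> (x + y) = \<alpha> x + \<alpha> y) \<and>
     (\<forall>c x. \<alpha> (c *\<^sub>C x) = c *\<^sub>C \<alpha> x) \<and>
     (\<forall>x y. \<alpha> (x * y) = \<alpha> x * \<alpha> y) \<and>
     (\<forall>x. \<alpha> (star x) = star (\<alpha> x))"

section \<open>The state space\<close>

definition linear_functional :: "('a::cstar_algebra_1 \<Rightarrow> complex) \<Rightarrow> bool" where
  "linear_functional \<phi> \<longleftrightarrow>
     (\<forall>x y. \<phi> (x + y) = \<phi> x + \<phi> y) \<and> (\<forall>c x. \<phi> (c *\<^sub>C x) = c * \<phi> x)"

definition positive_functional :: "('a::cstar_algebra_1 \<Rightarrow> complex) \<Rightarrow> bool" where
  "positive_functional \<phi> \<longleftrightarrow>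
     linear_functional \<phi> \<and> (\<forall>x. \<phi> (star x * x) \<in> \<real>\<^sub>\<ge>\<^sub>0)"

definition states :: "('a::cstar_algebra_1 \<Rightarrow> complex) set" where
  "states = {\<phi>. positive_functional \<phi> \<and> \<phi> 1 = 1}"

text \<open>
  The weak* topology is the topology of pointwise convergence on \<open>'a\<close>, i.e. the one induced
  from the product of copies of \<open>complex\<close> indexed by \<open>'a\<close>.
\<close>

definition state_space :: "('a::cstar_algebra_1 \<Rightarrow> complex) topology" where
  "state_space = subtopology (product_topology (\<lambda>_. euclidean) UNIV) states"

section \<open>Topological entropy\<close>

definition finite_open_cover :: "'b topology \<Rightarrow> 'b set set \<Rightarrow> bool" where
  "finite_open_cover X \<U> \<longleftrightarrow> finite \<U> \<and> (\<forall>U\<in>\<U>. openin X U) \<and> \<Union>\<U> = topspace X"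

definition cover_number :: "'b topology \<Rightarrow> 'b set set \<Rightarrow> nat" where
  "cover_number X \<U> =
     (LEAST k. \<exists>\<V>\<subseteq>\<U>. finite \<V> \<and> \<Union>\<V> = topspace X \<and> card \<V> = k)"

definition cover_join :: "'b set set \<Rightarrow> 'b set set \<Rightarrow> 'b set set" where
  "cover_join \<U> \<V> = {U \<inter> V | U V. U \<in> \<U> \<and> V \<in> \<V>}"

definition cover_preimage :: "'b topology \<Rightarrow> ('b \<Rightarrow> 'b) \<Rightarrow> 'b set set \<Rightarrow> 'b set set" where
  "cover_preimage X T \<U> = {topspace X \<inter> T -` U | U. U \<in> \<U>}"

text \<open>
  \<open>iterated_join X T \<U> n\<close> is the join of the first \<open>n\<close> preimages of \<open>\<U>\<close>, with exponents
  \<open>0, \<dots>, n - 1\<close>; the empty join is the trivial cover.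
\<close>

primrec iterated_join ::
    "'b topology \<Rightarrow> ('b \<Rightarrow> 'b) \<Rightarrow> 'b set set \<Rightarrow> nat \<Rightarrow> 'b set set" where
  "iterated_join X T \<U> 0 = {topspace X}"
| "iterated_join X T \<U> (Suc n) =
     cover_join (iterated_join X T \<U> n) (cover_preimage X (T ^^ n) \<U>)"

definition cover_entropy :: "'b topology \<Rightarrow> ('b \<Rightarrow> 'b) \<Rightarrow> 'b set set \<Rightarrow> real" where
  "cover_entropy X T \<U> =
     lim (\<lambda>n. ln (real (cover_number X (iterated_join X T \<U> n))) / real n)"

definition topological_entropy :: "'b topology \<Rightarrow> ('b \<Rightarrow> 'b) \<Rightarrow> ereal" where
  "topological_entropy X T =
     (SUP \<U> \<in> {\<U>. finite_open_cover X \<U>}. ereal (cover_entropy X T \<U>))"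

end

theory Submission
  imports Defs "HOL-Computational_Algebra.Formal_Power_Series"
begin

text \<open>
  Only the compactness of the state space and the affinity of the evaluations
  $f(\sigma) = \mathrm{Re}\,\sigma(a)$ matter. If some open cover has positive entropy, then for
  large $n$ there are exponentially many states whose orbits pairwise differ, by a fixed amount
  and in one of finitely many evaluations, at a fixed proportion of the times below $n$. A
  Sauer--Shelah argument turns this into a single evaluation $f$, levels $s < t$ and sets $W$ of
  at least $\delta n$ times below $n$ such that every pattern of "$\le s$" and "$\ge t$" along $W$ is
  realised by the orbit of some state. By convexity every function from $W$ to $[s, t]$ is then
  realised as well, so that the cover of the state space by the sets on which $f$ varies by less
  than $(t - s) / k$ has entropy at least $\delta \log (k + 1)$. Now let $k$ tend to infinity.
\<close>

section \<open>Entropy of a finite cover\<close>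

text \<open>The difficulty is to lose only constant factors in the exponents. At a given time an
  evaluation may lie strictly between the two levels, so orbits are partial binary words and the
  usual Sauer-Shelah count does not apply directly: splitting on a coordinate could isolate a tiny
  class of states. Separation at a fixed proportion of times cures this. Averaging over pairs finds
  a coordinate at which the low class and the high class each contain a \<open>1 / K\<close> part of
  the states, with \<open>K\<close> independent of the number of times. From \<open>K ^ r\<close>
  states, with \<open>r\<close> proportional to \<open>n\<close>, one can split \<open>r\<close>
  times and obtain \<open>2 ^ r\<close> shattered sets; there are too few small sets to account for
  them all, so some shattered set has size proportional to \<open>n\<close>. Proportional separation
  is available because allowing an orbit to leave its model at few times multiplies the number of
  cover elements only by a small exponential. The divergence at the end rests on the order of
  choice: the proportion \<delta> comes from the given cover, before \<open>k\<close> is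
  chosen.\<close>

lemma fekete_convergent:
  fixes a :: "nat \<Rightarrow> real"
  assumes sub: "\<And>m n. a (m + n) \<le> a m + a n" and nonneg: "\<And>n. 0 \<le> a n"
  shows "convergent (\<lambda>n. a n / real n)"
proof -
  define L where "L = (INF n\<in>{1..}. a n / real n)"
  have bdd: "bdd_below ((\<lambda>n. a n / real n) ` {1..})"
    by (rule bdd_belowI2[of _ 0]) (simp add: nonneg)
  have lower: "L \<le> a n / real n" if "n \<ge> 1" for n
    unfolding L_def using that by (intro cINF_lower bdd) auto
  have "(\<lambda>n. a n / real n) \<longlonglongrightarrow> L"
  proof (rule LIMSEQ_I)
    fix e :: real assume e: "0 < e"
    have "\<exists>p\<in>{1..}. a p / real p < L + e / 2"
      unfolding L_def using e by (subst cINF_less_iff[OF _ bdd, symmetric]) auto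
    then obtain p where p: "p \<ge> 1" "a p / real p < L + e / 2" by auto
    \<comment> \<open>A crude common bound for all remainders \<open>a (n mod p)\<close>; since it
      does not depend on \<open>n\<close>, \<open>B / n\<close> vanishes in the limit.\<close>
    define B where "B = (\<Sum>r<p. a r)"
    have mult: "a (q * p + r) \<le> real q * a p + a r" for q r
    proof (induction q)
      case (Suc q)
      have "a (Suc q * p + r) \<le> a p + a (q * p + r)"
        using sub[of p "q * p + r"] by (simp add: add.assoc)
      with Suc show ?case by (simp add: algebra_simps)
    qed simp
    have upper: "a n / real n \<le> a p / real p + B / real n" if n: "n \<ge> 1" for n
    proof -
      have "a n \<le> real (n div p) * a p + a (n mod p)"
        using mult[of "n div p" "n mod p"] by simp
      also have "a (n mod p) \<le> B"
        unfolding B_def using p nonneg by (intro member_le_sum) auto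
      also have "real (n div p) * a p \<le> real n / real p * a p"
        using nonneg by (intro mult_right_mono of_nat_div_le_of_nat) simp_all
      finally have "a n \<le> real n / real p * a p + B" by simp
      then have "a n / real n \<le> (real n / real p * a p + B) / real n"
        by (rule divide_right_mono) simp
      also have "\<dots> = a p / real p + B / real n"
        using n by (simp add: field_simps)
      finally show ?thesis .
    qed
    obtain N where N: "2 * B / e < real N" using reals_Archimedean2 by blast
    show "\<exists>no. \<forall>n\<ge>no. norm (a n / real n - L) < e"
    proof (intro exI allI impI)
      fix n assume n: "max 1 N \<le> n"
      have "2 * B / e < real n" using N n by linarith
      then have "B / real n < e / 2" using e n by (simp add: field_simps)
      with upper[of n] lower[of n] p n have "a n / real n < L + e" "L \<le> a n / real n"
        by linarith+
      then show "norm (a n / real n - L) < e" by (simp add: abs_less_iff)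
    qed
  qed
  then show ?thesis by (rule convergentI)
qed

section \<open>Cover numbers, itineraries and existence of the entropy limit\<close>

lemma cover_number_le:
  assumes "finite P" and "\<And>p. p \<in> P \<Longrightarrow> g p \<in> \<U>" and "\<Union>\<U> = topspace X"
    and "\<And>x. x \<in> topspace X \<Longrightarrow> \<exists>p\<in>P. x \<in> g p"
  shows "cover_number X \<U> \<le> card P"
proof -
  have "cover_number X \<U> \<le> card (g ` P)"
    unfolding cover_number_def
  proof (rule Least_le, intro exI conjI)
    show "g ` P \<subseteq> \<U>" "finite (g ` P)" using assms by auto
    show "\<Union> (g ` P) = topspace X" using assms by fastforce
  qed simp
  also have "\<dots> \<le> card P" using assms(1) by (rule card_image_le)
  finally show ?thesis .
qed

lemma cover_number_attained:
  assumes "finite \<U>" and "\<Union>\<U> = topspace X"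
  obtains \<V> where "\<V> \<subseteq> \<U>" "finite \<V>" "\<Union>\<V> = topspace X" "card \<V> = cover_number X \<U>"
proof -
  have "\<exists>\<V>\<subseteq>\<U>. finite \<V> \<and> \<Union>\<V> = topspace X \<and> card \<V> = cover_number X \<U>"
    unfolding cover_number_def
    by (rule LeastI_ex, rule exI[of _ "card \<U>"], rule exI[of _ \<U>]) (simp add: assms)
  then show ?thesis using that by blast
qed

lemma cover_number_pos:
  assumes "finite \<U>" and "\<Union>\<U> = topspace X" and "topspace X \<noteq> {}"
  shows "0 < cover_number X \<U>"
proof -
  obtain \<V> where "\<V> \<subseteq> \<U>" "finite \<V>" "\<Union>\<V> = topspace X" "card \<V> = cover_number X \<U>"
    by (rule cover_number_attained[OF assms(1,2)])
  with assms(3) show ?thesis by (metis Union_empty card_gt_0_iff)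
qed

text \<open>The empty family is a subcover here. With \<open>ln 0 = 0\<close> every cover entropy of
  an empty space is 0, so positive entropy later yields a point.\<close>

lemma cover_number_empty_space:
  assumes "topspace X = {}"
  shows "cover_number X \<U> = 0"
proof -
  have "cover_number X \<U> \<le> card ({} :: 'a set set)"
    unfolding cover_number_def using assms by (intro Least_le) auto
  then show ?thesis by simp
qed

text \<open>The itinerary \<open>u\<close> is a total function whose values from \<open>n\<close> on
  are irrelevant, so itineraries can be prolonged by a function update and concatenated by a case
  distinction.\<close>

definition cylinder :: "'b topology \<Rightarrow> ('b \<Rightarrow> 'b) \<Rightarrow> nat \<Rightarrow> (nat \<Rightarrow> 'b set) \<Rightarrow> 'b set" where
  "cylinder X T n u = {x \<in> topspace X. \<forall>i<n. (T ^^ i) x \<in> u i}"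

lemma iterated_join_eq_cylinders:
  "iterated_join X T \<U> n = {cylinder X T n u | u. \<forall>i<n. u i \<in> \<U>}"
proof (induction n)
  case 0
  then show ?case by (auto simp: cylinder_def)
next
  case (Suc n)
  have split: "cylinder X T (Suc n) u = cylinder X T n u \<inter> (topspace X \<inter> (T ^^ n) -` u n)" for u
    by (auto simp: cylinder_def less_Suc_eq)
  show ?case
  proof (intro set_eqI iffI)
    fix S assume "S \<in> iterated_join X T \<U> (Suc n)"
    then obtain u U where u: "\<forall>i<n. u i \<in> \<U>" and U: "U \<in> \<U>"
      and S: "S = cylinder X T n u \<inter> (topspace X \<inter> (T ^^ n) -` U)"
      unfolding iterated_join.simps Suc cover_join_def cover_preimage_def by blast
    have "S = cylinder X T (Suc n) (u(n := U))"
      unfolding S split by (auto simp: cylinder_def)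
    with u U show "S \<in> {cylinder X T (Suc n) u | u. \<forall>i<Suc n. u i \<in> \<U>}"
      by (auto simp: less_Suc_eq intro!: exI[of _ "u(n := U)"])
  next
    fix S assume "S \<in> {cylinder X T (Suc n) u | u. \<forall>i<Suc n. u i \<in> \<U>}"
    then obtain u where "\<forall>i<Suc n. u i \<in> \<U>" and "S = cylinder X T (Suc n) u" by blast
    then have "cylinder X T n u \<in> {cylinder X T n u | u. \<forall>i<n. u i \<in> \<U>}" "u n \<in> \<U>"
      and "S = cylinder X T n u \<inter> (topspace X \<inter> (T ^^ n) -` u n)"
      by (auto simp: split)
    then show "S \<in> iterated_join X T \<U> (Suc n)"
      unfolding iterated_join.simps Suc cover_join_def cover_preimage_def by blast
  qed
qed

lemma iterated_join_finite: "finite \<U> \<Longrightarrow> finite (iterated_join X T \<U> n)"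
  unfolding iterated_join_eq_cylinders
proof (rule finite_subset)
  show "{cylinder X T n u | u. \<forall>i<n. u i \<in> \<U>} \<subseteq> cylinder X T n ` ({..<n} \<rightarrow>\<^sub>E \<U>)"
  proof clarify
    fix u assume "\<forall>i<n. u i \<in> \<U>"
    \<comment> \<open>Infinitely many itineraries give the same cylinder; restriction leaves a
      finite function space.\<close>
    moreover have "cylinder X T n u = cylinder X T n (restrict u {..<n})"
      by (auto simp: cylinder_def)
    ultimately show "cylinder X T n u \<in> cylinder X T n ` ({..<n} \<rightarrow>\<^sub>E \<U>)" by auto
  qed
qed (simp add: finite_PiE)

locale finite_cover_system =
  fixes X :: "'b topology" and T :: "'b \<Rightarrow> 'b" and \<U> :: "'b set set"
  assumes maps: "x \<in> topspace X \<Longrightarrow> T x \<in> topspace X"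
    and finite_cover: "finite \<U>"
    and cover: "\<Union>\<U> = topspace X"
begin

abbreviation N :: "nat \<Rightarrow> nat" where
  "N n \<equiv> cover_number X (iterated_join X T \<U> n)"

lemma funpow_maps: "x \<in> topspace X \<Longrightarrow> (T ^^ n) x \<in> topspace X"
  by (induction n) (auto intro: maps)

lemma Union_iterated_join: "\<Union>(iterated_join X T \<U> n) = topspace X"
proof
  show "\<Union>(iterated_join X T \<U> n) \<subseteq> topspace X"
    by (auto simp: iterated_join_eq_cylinders cylinder_def)
next
  show "topspace X \<subseteq> \<Union>(iterated_join X T \<U> n)"
  proof
    fix x assume x: "x \<in> topspace X"
    have "\<forall>i. \<exists>U\<in>\<U>. (T ^^ i) x \<in> U" using funpow_maps[OF x] cover by blast
    then obtain u where "\<forall>i. u i \<in> \<U> \<and> (T ^^ i) x \<in> u i" by metis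
    with x show "x \<in> \<Union>(iterated_join X T \<U> n)"
      by (auto simp: iterated_join_eq_cylinders cylinder_def)
  qed
qed

text \<open>An optimal subcover for the first \<open>m\<close> times, intersected with the preimage
  under \<open>T ^^ m\<close> of one for \<open>n\<close> times, covers the space; the itinerary of
  each intersection is the concatenation of the two.\<close>

lemma N_submultiplicative: "N (m + n) \<le> N m * N n"
proof -
  obtain \<V> where V: "\<V> \<subseteq> iterated_join X T \<U> m" "finite \<V>" "\<Union>\<V> = topspace X" "card \<V> = N m"
    by (rule cover_number_attained[OF iterated_join_finite[OF finite_cover] Union_iterated_join])
  obtain \<W> where W: "\<W> \<subseteq> iterated_join X T \<U> n" "finite \<W>" "\<Union>\<W> = topspace X" "card \<W> = N n"
    by (rule cover_number_attained[OF iterated_join_finite[OF finite_cover] Union_iterated_join])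
  have "N (m + n) \<le> card (\<V> \<times> \<W>)"
  proof (rule cover_number_le[where g = "\<lambda>(A, B). A \<inter> {x \<in> topspace X. (T ^^ m) x \<in> B}"])
    show "finite (\<V> \<times> \<W>)" using V W by simp
  next
    fix p assume "p \<in> \<V> \<times> \<W>"
    then obtain A B where p: "p = (A, B)" "A \<in> \<V>" "B \<in> \<W>" by blast
    obtain u where u: "A = cylinder X T m u" "\<forall>i<m. u i \<in> \<U>"
      using V p by (auto simp: iterated_join_eq_cylinders)
    obtain v where v: "B = cylinder X T n v" "\<forall>i<n. v i \<in> \<U>"
      using W p by (auto simp: iterated_join_eq_cylinders)
    let ?w = "\<lambda>i. if i < m then u i else v (i - m)"
    have "A \<inter> {x \<in> topspace X. (T ^^ m) x \<in> B} = cylinder X T (m + n) ?w"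
    proof (intro set_eqI iffI)
      fix x assume x: "x \<in> A \<inter> {x \<in> topspace X. (T ^^ m) x \<in> B}"
      have "(T ^^ i) x \<in> ?w i" if "i < m + n" for i
      proof (cases "i < m")
        case False
        have "(T ^^ (i - m)) ((T ^^ m) x) \<in> v (i - m)"
          using x v that False by (auto simp: cylinder_def)
        moreover have "(T ^^ (i - m)) ((T ^^ m) x) = (T ^^ i) x"
          using False funpow_add[of "i - m" m T] by simp
        ultimately show ?thesis using False by simp
      qed (use x u in \<open>auto simp: cylinder_def\<close>)
      with x show "x \<in> cylinder X T (m + n) ?w" by (auto simp: cylinder_def)
    next
      fix x assume x: "x \<in> cylinder X T (m + n) ?w"
      then have top: "x \<in> topspace X" by (simp add: cylinder_def)
      have "(T ^^ i) ((T ^^ m) x) \<in> v i" if "i < n" for i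
      proof -
        have "i + m < m + n" using that by simp
        then have "(T ^^ (i + m)) x \<in> ?w (i + m)" using x that unfolding cylinder_def by blast
        then show ?thesis by (simp add: funpow_add)
      qed
      moreover have "(T ^^ i) x \<in> u i" if "i < m" for i
      proof -
        have "(T ^^ i) x \<in> ?w i" using x that unfolding cylinder_def by (auto dest!: spec[of _ i])
        with that show ?thesis by simp
      qed
      ultimately show "x \<in> A \<inter> {x \<in> topspace X. (T ^^ m) x \<in> B}"
        using top funpow_maps[OF top] by (simp add: u v cylinder_def)
    qed
    moreover have "\<forall>i<m + n. ?w i \<in> \<U>" using u v by auto
    ultimately show "(case p of (A, B) \<Rightarrow> A \<inter> {x \<in> topspace X. (T ^^ m) x \<in> B})
        \<in> iterated_join X T \<U> (m + n)"
      unfolding iterated_join_eq_cylinders p by auto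
  next
    show "\<Union>(iterated_join X T \<U> (m + n)) = topspace X" by (rule Union_iterated_join)
  next
    fix x assume x: "x \<in> topspace X"
    then obtain A B where "A \<in> \<V>" "x \<in> A" "B \<in> \<W>" "(T ^^ m) x \<in> B"
      using V W funpow_maps[OF x, of m] by blast
    then show "\<exists>p\<in>\<V> \<times> \<W>. x \<in> (case p of (A, B) \<Rightarrow> A \<inter> {x \<in> topspace X. (T ^^ m) x \<in> B})"
      using x by (intro bexI[of _ "(A, B)"]) auto
  qed
  with V W show ?thesis by (simp add: card_cartesian_product)
qed

text \<open>Turns the \<open>lim\<close> of the definition into a true limit:
  \<open>ln (N n)\<close> is subadditive, and nonnegative since a nonempty space needs at least one
  set.\<close>

lemma cover_entropy_tendsto:
  assumes "topspace X \<noteq> {}"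
  shows "(\<lambda>n. ln (real (N n)) / real n) \<longlonglongrightarrow> cover_entropy X T \<U>"
proof -
  have pos: "0 < N n" for n
    by (intro cover_number_pos iterated_join_finite finite_cover Union_iterated_join assms)
  have "convergent (\<lambda>n. ln (real (N n)) / real n)"
  proof (rule fekete_convergent)
    fix m n
    have "ln (real (N (m + n))) \<le> ln (real (N m) * real (N n))"
      using N_submultiplicative[of m n] pos by (simp flip: of_nat_mult)
    also have "\<dots> = ln (real (N m)) + ln (real (N n))"
      using pos by (simp add: ln_mult)
    finally show "ln (real (N (m + n))) \<le> ln (real (N m)) + ln (real (N n))" .
  next
    fix n show "0 \<le> ln (real (N n))" using pos[of n] by simp
  qed
  then show ?thesis
    unfolding cover_entropy_def by (rule convergent_LIMSEQ_iff[THEN iffD1])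
qed

section \<open>From entropy to separated orbits\<close>

text \<open>A cylinder containing \<open>x\<close> is encoded by a center \<open>y\<close>, the set
  \<open>B\<close> of times at which \<open>x\<close> leaves the orbit of \<open>y\<close>, and free
  choices from the cover at those times; at all other times the orbit of \<open>y\<close> dictates
  the cover element. The bound counts these codes.\<close>

lemma N_le_card_centers:
  fixes d :: real
  assumes near: "\<And>y. y \<in> topspace X \<Longrightarrow> \<exists>U\<in>\<U>. \<forall>x\<in>topspace X. near y x \<longrightarrow> x \<in> U"
    and A: "A \<subseteq> topspace X" "finite A"
    and centers: "\<And>x. x \<in> topspace X \<Longrightarrow>
      \<exists>y\<in>A. real (card {i. i < n \<and> \<not> near ((T ^^ i) y) ((T ^^ i) x)}) \<le> d"
  shows "N n \<le> card A * (\<Sum>B | B \<subseteq> {..<n} \<and> real (card B) \<le> d. card \<U> ^ card B)"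
proof -
  obtain V where V: "\<And>y. y \<in> topspace X \<Longrightarrow> V y \<in> \<U> \<and> (\<forall>x\<in>topspace X. near y x \<longrightarrow> x \<in> V y)"
    using near by metis
  define \<B> where "\<B> = {B. B \<subseteq> {..<n} \<and> real (card B) \<le> d}"
  have fin: "finite \<B>" "\<And>B. B \<in> \<B> \<Longrightarrow> finite B"
    by (auto simp: \<B>_def intro: finite_subset)
  define P where "P = A \<times> (SIGMA B:\<B>. B \<rightarrow>\<^sub>E \<U>)"
  define g where "g = (\<lambda>(y, B, u). cylinder X T n (\<lambda>i. if i \<in> B then u i else V ((T ^^ i) y)))"
  have "N n \<le> card P"
  proof (rule cover_number_le[where g = g])
    show "finite P" using A fin finite_cover by (auto simp: P_def intro!: finite_PiE)
    show "\<Union>(iterated_join X T \<U> n) = topspace X" by (rule Union_iterated_join)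
  next
    fix p assume "p \<in> P"
    then obtain y B u where p: "p = (y, B, u)" "y \<in> A" "B \<in> \<B>" "u \<in> B \<rightarrow>\<^sub>E \<U>"
      by (auto simp: P_def)
    have "(if i \<in> B then u i else V ((T ^^ i) y)) \<in> \<U>" for i
      using p A V funpow_maps by auto
    then show "g p \<in> iterated_join X T \<U> n"
      unfolding iterated_join_eq_cylinders g_def p by blast
  next
    fix x assume x: "x \<in> topspace X"
    then obtain y where y: "y \<in> A"
      and le: "real (card {i. i < n \<and> \<not> near ((T ^^ i) y) ((T ^^ i) x)}) \<le> d"
      using centers by blast
    define B where "B = {i. i < n \<and> \<not> near ((T ^^ i) y) ((T ^^ i) x)}"
    have "\<forall>i. \<exists>U\<in>\<U>. (T ^^ i) x \<in> U" using funpow_maps[OF x] cover by blast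
    then obtain u where u: "\<forall>i. u i \<in> \<U> \<and> (T ^^ i) x \<in> u i" by metis
    have "(y, B, restrict u B) \<in> P"
      using y u le by (auto simp: P_def B_def \<B>_def)
    moreover have "(T ^^ i) x \<in> V ((T ^^ i) y)" if "i < n" "i \<notin> B" for i
      using that V[of "(T ^^ i) y"] funpow_maps[OF x] funpow_maps[of y i] A y by (auto simp: B_def)
    then have "x \<in> g (y, B, restrict u B)"
      using x u by (auto simp: g_def cylinder_def)
    ultimately show "\<exists>p\<in>P. x \<in> g p" by blast
  qed
  also have "card P = card A * (\<Sum>B\<in>\<B>. card \<U> ^ card B)"
    using A fin finite_cover by (simp add: P_def card_cartesian_product card_PiE finite_PiE)
  finally show ?thesis by (simp add: \<B>_def)
qed

text \<open>Greedy selection: if a separated set of fewer than \<open>k\<close> points could not be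
  enlarged, its points would be centers for the whole space, and \<open>N_le_card_centers\<close>
  would contradict \<open>large\<close>.\<close>

lemma exists_separated:
  fixes d :: real
  assumes near: "\<And>y. y \<in> topspace X \<Longrightarrow> \<exists>U\<in>\<U>. \<forall>x\<in>topspace X. near y x \<longrightarrow> x \<in> U"
    and sym: "\<And>x y. near x y \<Longrightarrow> near y x" and refl: "\<And>x. near x x" and d: "0 \<le> d"
    and large: "k * (\<Sum>B | B \<subseteq> {..<n} \<and> real (card B) \<le> d. card \<U> ^ card B) < N n"
  shows "\<exists>A. A \<subseteq> topspace X \<and> finite A \<and> card A = k \<and>
    (\<forall>x\<in>A. \<forall>y\<in>A. x \<noteq> y \<longrightarrow> d < real (card {i. i < n \<and> \<not> near ((T ^^ i) x) ((T ^^ i) y)}))"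
proof -
  define bad where "bad x y = real (card {i. i < n \<and> \<not> near ((T ^^ i) x) ((T ^^ i) y)})" for x y
  have bad_sym: "bad x y = bad y x" for x y
    unfolding bad_def by (intro arg_cong[where f = "\<lambda>S. real (card S)"]) (auto dest: sym)
  have "j \<le> k \<Longrightarrow> \<exists>A. A \<subseteq> topspace X \<and> finite A \<and> card A = j \<and>
      (\<forall>x\<in>A. \<forall>y\<in>A. x \<noteq> y \<longrightarrow> d < bad x y)" for j
  proof (induction j)
    case 0
    show ?case by (intro exI[of _ "{}"]) auto
  next
    case (Suc j)
    then obtain A where A: "A \<subseteq> topspace X" "finite A" "card A = j"
      and sep: "\<forall>x\<in>A. \<forall>y\<in>A. x \<noteq> y \<longrightarrow> d < bad x y" by auto
    have "\<exists>x\<in>topspace X. \<forall>y\<in>A. d < bad y x"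
    proof (rule ccontr)
      assume "\<not> ?thesis"
      then have "\<And>x. x \<in> topspace X \<Longrightarrow> \<exists>y\<in>A. bad y x \<le> d" by (meson not_le)
      then have "N n \<le> card A * (\<Sum>B | B \<subseteq> {..<n} \<and> real (card B) \<le> d. card \<U> ^ card B)"
        unfolding bad_def by (intro N_le_card_centers[OF near A(1,2)])
      also have "\<dots> \<le> k * (\<Sum>B | B \<subseteq> {..<n} \<and> real (card B) \<le> d. card \<U> ^ card B)"
        using Suc.prems A by (intro mult_right_mono) auto
      finally show False using large by simp
    qed
    then obtain x where x: "x \<in> topspace X" "\<forall>y\<in>A. d < bad y x" by blast
    \<comment> \<open>Reflexivity and \<open>0 \<le> d\<close> guarantee that the point found is
      new, so the cardinality really grows.\<close>
    have "bad x x = 0" by (simp add: bad_def refl)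
    with x d have "x \<notin> A" by fastforce
    moreover have "\<forall>a\<in>insert x A. \<forall>b\<in>insert x A. a \<noteq> b \<longrightarrow> d < bad a b"
      using sep x(2) bad_sym by auto
    ultimately show ?case
      using A x(1) by (intro exI[of _ "insert x A"]) simp
  qed
  from this[of k] show ?thesis by (simp add: bad_def)
qed

end

section \<open>Shattered sets\<close>

lemma sum_power_card_Pow:
  fixes u :: "'a::comm_semiring_1"
  assumes "finite I"
  shows "(\<Sum>B\<in>Pow I. u ^ card B) = (1 + u) ^ card I"
  using prod_add[OF assms, of "\<lambda>_. u" "\<lambda>_. 1"] by (simp add: add.commute)

text \<open>Serves two purposes: with \<open>u\<close> the size of the cover it prices the free
  choices at exceptional times, and with \<open>u = 1\<close> it shows that few sets are small. The
  essential point is that \<open>g\<close> is chosen before \<open>I\<close>.\<close>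

lemma sum_small_subsets_le_exp:
  fixes u e :: real
  assumes "0 \<le> u" and "0 < e"
  obtains g where "0 < g"
    and "\<And>I :: 'i set. finite I \<Longrightarrow>
      (\<Sum>B | B \<subseteq> I \<and> real (card B) \<le> g * real (card I). u ^ card B) \<le> exp (e * real (card I))"
proof -
  \<comment> \<open>exponential moment bound: weighting \<open>B\<close> with \<open>x\<close> to the power \<open>card B - g * card I\<close>\<close>
  define x where "x = min (1/2) (e / 2 / (u + 1))"
  have x: "0 < x" "x < 1" using assms by (auto simp: x_def)
  have "u * x \<le> (u + 1) * (e / 2 / (u + 1))"
    using assms x by (intro mult_mono) (auto simp: x_def)
  also have "\<dots> = (u + 1) * (e / 2) / (u + 1)" by (rule times_divide_eq_right)
  also have "\<dots> = e / 2"
    using assms by (intro nonzero_mult_div_cancel_left) auto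
  finally have ux: "u * x \<le> e / 2" .
  \<comment> \<open>Chosen so that \<open>x\<close> to the power \<open>- g * card I\<close> is
    \<open>exp (e / 2 * card I)\<close>; the other half of the exponent pays for the full sum of
    \<open>(u * x) ^ card B\<close>.\<close>
  define g where "g = e / (2 * ln (1 / x))"
  have lnx: "ln (1 / x) > 0" using x by simp
  have "g > 0" using assms lnx by (simp add: g_def)
  moreover have "(\<Sum>B | B \<subseteq> I \<and> real (card B) \<le> g * real (card I). u ^ card B)
      \<le> exp (e * real (card I))" if fin: "finite I" for I :: "'i set"
  proof -
    let ?n = "real (card I)"
    have "u ^ card B \<le> exp (e / 2 * ?n) * (u * x) ^ card B"
      if "real (card B) \<le> g * ?n" for B :: "'i set"
    proof -
      have "exp (- (e / 2 * ?n)) = exp (g * ?n * ln x)"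
        using lnx x by (simp add: g_def ln_div field_simps)
      also have "\<dots> \<le> exp (real (card B) * ln x)"
        using that x by (simp add: mult_right_mono_neg)
      also have "\<dots> = x ^ card B" using x by (simp add: exp_of_nat_mult)
      finally have "1 \<le> exp (e / 2 * ?n) * x ^ card B"
        by (simp add: exp_minus field_simps)
      then have "u ^ card B * 1 \<le> u ^ card B * (exp (e / 2 * ?n) * x ^ card B)"
        using assms by (intro mult_left_mono) auto
      then show ?thesis by (simp add: power_mult_distrib ac_simps)
    qed
    then have "(\<Sum>B | B \<subseteq> I \<and> real (card B) \<le> g * ?n. u ^ card B)
        \<le> (\<Sum>B | B \<subseteq> I \<and> real (card B) \<le> g * ?n. exp (e / 2 * ?n) * (u * x) ^ card B)"
      by (intro sum_mono) auto
    also have "\<dots> \<le> (\<Sum>B\<in>Pow I. exp (e / 2 * ?n) * (u * x) ^ card B)"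
      using fin assms x by (intro sum_mono2) auto
    also have "\<dots> = exp (e / 2 * ?n) * (1 + u * x) ^ card I"
      by (simp add: sum_power_card_Pow[OF fin] flip: sum_distrib_left)
    also have "(1 + u * x) ^ card I \<le> exp (u * x) ^ card I"
      using assms x by (intro power_mono exp_ge_add_one_self) auto
    also have "\<dots> \<le> exp (e / 2) ^ card I"
      using ux by (intro power_mono) auto
    also have "exp (e / 2 * ?n) * exp (e / 2) ^ card I = exp (e * ?n)"
      by (simp add: exp_of_nat_mult[symmetric] exp_add[symmetric] field_simps)
    finally show ?thesis by simp
  qed
  ultimately show ?thesis by (rule that)
qed

section \<open>A Sauer-Shelah count for partial coordinates\<close>

text \<open>
  Coordinates are partial: at a coordinate a point may satisfy \<open>lo\<close>, \<open>hi\<close>, neither, or both.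
\<close>

definition shatters :: "('c \<Rightarrow> 'b \<Rightarrow> bool) \<Rightarrow> ('c \<Rightarrow> 'b \<Rightarrow> bool) \<Rightarrow> 'b set \<Rightarrow> 'c set \<Rightarrow> bool" where
  "shatters lo hi A W \<longleftrightarrow>
     (\<forall>J\<subseteq>W. \<exists>x\<in>A. \<forall>c\<in>W. (c \<in> J \<longrightarrow> hi c x) \<and> (c \<notin> J \<longrightarrow> lo c x))"

definition split_coords :: "('c \<Rightarrow> 'b \<Rightarrow> bool) \<Rightarrow> ('c \<Rightarrow> 'b \<Rightarrow> bool) \<Rightarrow> 'c set \<Rightarrow> 'b \<Rightarrow> 'b \<Rightarrow> 'c set" where
  "split_coords lo hi C x y = {c \<in> C. lo c x \<and> hi c y \<or> hi c x \<and> lo c y}"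

lemma shatters_mono:
  assumes "shatters lo hi A W" and "A \<subseteq> B" and "V \<subseteq> W"
  shows "shatters lo hi B V"
  unfolding shatters_def
proof (intro allI impI)
  fix J assume "J \<subseteq> V"
  then obtain x where "x \<in> A" "\<forall>c\<in>W. (c \<in> J \<longrightarrow> hi c x) \<and> (c \<notin> J \<longrightarrow> lo c x)"
    using assms unfolding shatters_def by (metis subset_trans)
  with assms show "\<exists>x\<in>B. \<forall>c\<in>V. (c \<in> J \<longrightarrow> hi c x) \<and> (c \<notin> J \<longrightarrow> lo c x)" by blast
qed

text \<open>The pattern at \<open>c\<close> decides from which of the two classes the witness is
  drawn; the rest of the pattern is handled inside that class.\<close>

lemma shatters_insert:
  assumes "shatters lo hi {x \<in> A. lo c x} W" and "shatters lo hi {x \<in> A. hi c x} W"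
  shows "shatters lo hi A (insert c W)"
  unfolding shatters_def
proof (intro allI impI)
  fix J assume J: "J \<subseteq> insert c W"
  have "\<exists>x\<in>A. (c \<in> J \<longrightarrow> hi c x) \<and> (c \<notin> J \<longrightarrow> lo c x) \<and>
      (\<forall>d\<in>W. (d \<in> J \<inter> W \<longrightarrow> hi d x) \<and> (d \<notin> J \<inter> W \<longrightarrow> lo d x))"
    using assms unfolding shatters_def
    by (cases "c \<in> J") (fastforce dest!: spec[of _ "J \<inter> W"])+
  then show "\<exists>x\<in>A. \<forall>d\<in>insert c W. (d \<in> J \<longrightarrow> hi d x) \<and> (d \<notin> J \<longrightarrow> lo d x)"
    by (metis Int_iff insert_iff)
qed

text \<open>
  Counts the triples \<open>(x, y, c)\<close> with \<open>lo c x\<close> and \<open>hi c y\<close>; a coordinate with many such pairs has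
  both classes large. This lets the recursion below split on one coordinate at the cost of a
  constant factor, independent of the number of coordinates.
\<close>

lemma exists_balanced_coord:
  fixes m :: real
  assumes fin: "finite C" "finite A" and ne: "C \<noteq> {}"
    and two: "2 \<le> card A" and m: "0 \<le> m"
    and sep: "\<And>x y. x \<in> A \<Longrightarrow> y \<in> A \<Longrightarrow> x \<noteq> y \<Longrightarrow> m \<le> real (card (split_coords lo hi C x y))"
  obtains c where "c \<in> C"
    and "m * real (card A) \<le> 4 * real (card C) * real (card {x \<in> A. lo c x})"
    and "m * real (card A) \<le> 4 * real (card C) * real (card {x \<in> A. hi c x})"
proof -
  let ?a = "real (card A)"
  define L where "L c = {x \<in> A. lo c x}" for c
  define H where "H c = {x \<in> A. hi c x}" for c
  have fLH: "finite (L c)" "finite (H c)" for c using fin by (auto simp: L_def H_def)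
  define p where "p x y = real (card {c \<in> C. lo c x \<and> hi c y})" for x y
  have "(\<Sum>c\<in>C. real (card (L c) * card (H c))) = (\<Sum>c\<in>C. \<Sum>x\<in>A. \<Sum>y\<in>A. of_bool (lo c x \<and> hi c y))"
  proof (rule sum.cong[OF refl])
    fix c
    have "(\<Sum>x\<in>A. \<Sum>y\<in>A. of_bool (lo c x \<and> hi c y) :: real)
        = (\<Sum>x\<in>A. of_bool (lo c x)) * (\<Sum>y\<in>A. of_bool (hi c y))"
      by (simp add: sum_product of_bool_conj)
    also have "\<dots> = real (card (L c) * card (H c))"
      using fin by (simp add: L_def H_def Int_def)
    finally show "real (card (L c) * card (H c)) = (\<Sum>x\<in>A. \<Sum>y\<in>A. of_bool (lo c x \<and> hi c y))" ..
  qed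
  also have "\<dots> = (\<Sum>x\<in>A. \<Sum>y\<in>A. p x y)"
    using fin unfolding p_def
    by (subst sum.swap, intro sum.cong refl, subst sum.swap) (simp add: Int_def)
  finally have total: "(\<Sum>c\<in>C. real (card (L c) * card (H c))) = (\<Sum>x\<in>A. \<Sum>y\<in>A. p x y)" .
  \<comment> \<open>Double counting: each ordered pair of distinct points is split by at least
    \<open>m\<close> coordinates, in one of the two orientations.\<close>
  have "?a * (?a - 1) * m = (\<Sum>x\<in>A. \<Sum>y\<in>A - {x}. m)"
    using fin two by (simp add: card_Diff_singleton of_nat_diff algebra_simps)
  also have "\<dots> \<le> (\<Sum>x\<in>A. \<Sum>y\<in>A - {x}. p x y + p y x)"
  proof (intro sum_mono)
    fix x y assume "x \<in> A" "y \<in> A - {x}"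
    then have "m \<le> real (card (split_coords lo hi C x y))" using sep by auto
    also have "split_coords lo hi C x y = {c \<in> C. lo c x \<and> hi c y} \<union> {c \<in> C. lo c y \<and> hi c x}"
      by (auto simp: split_coords_def)
    also have "real (card \<dots>) \<le> p x y + p y x"
      unfolding p_def of_nat_add[symmetric] of_nat_le_iff by (rule card_Un_le)
    finally show "m \<le> p x y + p y x" .
  qed
  also have "\<dots> \<le> (\<Sum>x\<in>A. \<Sum>y\<in>A. p x y + p y x)"
    using fin by (intro sum_mono sum_mono2) (auto simp: p_def)
  also have "\<dots> = (\<Sum>x\<in>A. \<Sum>y\<in>A. p x y) + (\<Sum>x\<in>A. \<Sum>y\<in>A. p y x)"
    by (simp only: sum.distrib)
  also have "(\<Sum>x\<in>A. \<Sum>y\<in>A. p y x) = (\<Sum>x\<in>A. \<Sum>y\<in>A. p x y)"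
    by (rule sum.swap)
  also have "(\<Sum>x\<in>A. \<Sum>y\<in>A. p x y) + \<dots> = 2 * (\<Sum>c\<in>C. real (card (L c) * card (H c)))"
    unfolding total by simp
  finally have lower: "?a * (?a - 1) * m \<le> 2 * (\<Sum>c\<in>C. real (card (L c) * card (H c)))" .
  \<comment> \<open>Some coordinate reaches the average of the products. As each factor is at most
    \<open>card A\<close>, a large product forces both factors to be large.\<close>
  have "\<exists>c\<in>C. ?a * (?a - 1) * m / (2 * real (card C)) \<le> real (card (L c) * card (H c))"
  proof (rule ccontr)
    assume "\<not> ?thesis"
    then have "(\<Sum>c\<in>C. real (card (L c) * card (H c)))
        < (\<Sum>c\<in>C. ?a * (?a - 1) * m / (2 * real (card C)))"
      using fin ne by (intro sum_strict_mono) (auto simp: not_le)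
    also have "\<dots> = ?a * (?a - 1) * m / 2"
      using fin ne by simp
    finally show False using lower by simp
  qed
  then obtain c where c: "c \<in> C"
    and "?a * (?a - 1) * m / (2 * real (card C)) \<le> real (card (L c) * card (H c))" by blast
  then have prod: "?a * (?a - 1) * m \<le> 2 * real (card C) * (real (card (L c)) * real (card (H c)))"
    using fin ne by (simp add: field_simps card_gt_0_iff)
  have bounds: "real (card (L c)) \<le> ?a" "real (card (H c)) \<le> ?a"
    using fin by (auto simp: L_def H_def intro!: card_mono)
  \<comment> \<open>Replacing \<open>card A - 1\<close> by \<open>card A / 2\<close> doubles the
    factor 2, whence the 4 in the conclusion.\<close>
  have half: "?a / 2 \<le> ?a - 1" using two by simp
  have key: "m * ?a \<le> 4 * real (card C) * s"
    if le: "?a * (?a - 1) * m \<le> 2 * real (card C) * (s * t)" and "0 \<le> s" "t \<le> ?a" for s t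
  proof -
    have "?a * (?a / 2 * m) \<le> ?a * ((?a - 1) * m)"
      using half m by (intro mult_left_mono mult_right_mono) auto
    also have "\<dots> \<le> 2 * real (card C) * (s * t)" using le by (simp add: mult.assoc)
    also have "\<dots> \<le> 2 * real (card C) * (s * ?a)"
      using that by (intro mult_left_mono) auto
    finally have "?a * (?a / 2 * m) \<le> ?a * (2 * real (card C) * s)" by (simp add: ac_simps)
    then show ?thesis using two by (simp add: mult_le_cancel_left field_simps)
  qed
  show ?thesis
  proof (rule that[OF c])
    show "m * ?a \<le> 4 * real (card C) * real (card {x \<in> A. lo c x})"
      using key[OF prod] bounds by (simp add: L_def)
    show "m * ?a \<le> 4 * real (card C) * real (card {x \<in> A. hi c x})"
      using key[OF prod[unfolded mult.commute[of "real (card (L c))"]]] bounds by (simp add: H_def)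
  qed
qed

text \<open>Induction on \<open>r\<close>: split on a balanced coordinate \<open>c\<close>, delete
  it, and count the sets shattered by each class. A set shattered by both classes counts twice, once
  as it is and once with \<open>c\<close> added. Deleting \<open>c\<close> lowers the separation by
  at most one, so the slack \<open>real r\<close> in \<open>sep\<close> lasts for exactly
  \<open>r\<close> splittings while \<open>m\<close>, and with it \<open>K\<close>, stays
  fixed.\<close>

lemma card_shattered_ge:
  fixes m K :: real
  assumes fin: "finite D" "finite A" and m: "0 < m" and K: "2 \<le> K" "4 * real (card D) \<le> K * m"
    and large: "K ^ r \<le> real (card A)"
    and sep: "\<And>x y. x \<in> A \<Longrightarrow> y \<in> A \<Longrightarrow> x \<noteq> y
      \<Longrightarrow> m + real r \<le> real (card (split_coords lo hi D x y))"
  shows "2 ^ r \<le> card {W. W \<subseteq> D \<and> shatters lo hi A W}"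
  using fin K(2) large sep
proof (induction r arbitrary: D A)
  case 0
  then have "A \<noteq> {}" by auto
  then have "{} \<in> {W. W \<subseteq> D \<and> shatters lo hi A W}" by (auto simp: shatters_def)
  moreover have "finite {W. W \<subseteq> D \<and> shatters lo hi A W}" using 0 by simp
  ultimately have "card {W. W \<subseteq> D \<and> shatters lo hi A W} > 0" by (auto simp: card_gt_0_iff)
  then show ?case by simp
next
  case (Suc r)
  have "K \<le> K ^ Suc r" using K by (simp add: self_le_power)
  then have two: "2 \<le> card A" using Suc.prems(4) K by linarith
  then obtain x y where "x \<in> A" "y \<in> A" "x \<noteq> y" by (metis card_2_iff' obtain_subset_with_card_n subsetD)
  then have "m + real (Suc r) \<le> real (card (split_coords lo hi D x y))" by (rule Suc.prems)
  then have ne: "D \<noteq> {}" using m by (auto simp: split_coords_def)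
  obtain c where c: "c \<in> D"
    and lo: "m * real (card A) \<le> 4 * real (card D) * real (card {x \<in> A. lo c x})"
    and hi: "m * real (card A) \<le> 4 * real (card D) * real (card {x \<in> A. hi c x})"
  proof (rule exists_balanced_coord[OF Suc.prems(1,2) ne two])
    fix x y assume "x \<in> A" "y \<in> A" "x \<noteq> y"
    from Suc.prems(5)[OF this] show "m \<le> real (card (split_coords lo hi D x y))" by simp
  qed (use m in auto)
  have step: "2 ^ r \<le> card {W. W \<subseteq> D - {c} \<and> shatters lo hi B W}"
    if B: "B \<subseteq> A" and le: "m * real (card A) \<le> 4 * real (card D) * real (card B)" for B
  proof (rule Suc.IH)
    show "finite (D - {c})" "finite B" using Suc.prems B by (auto intro: finite_subset)
    show "4 * real (card (D - {c})) \<le> K * m"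
      using Suc.prems(1,3) c by (simp add: card_Diff_singleton of_nat_diff)
    \<comment> \<open>Balance together with \<open>4 * card D \<le> K * m\<close> says that a class
      keeps at least a \<open>1 / K\<close> part of \<open>A\<close>; one power of \<open>K\<close>
      is spent per splitting.\<close>
    have "m * (K * K ^ r) \<le> m * real (card A)" using Suc.prems(4) m by simp
    also have "\<dots> \<le> 4 * real (card D) * real (card B)" by (rule le)
    also have "\<dots> \<le> K * m * real (card B)" using Suc.prems(3) by (intro mult_right_mono) auto
    finally have "(m * K) * K ^ r \<le> (m * K) * real (card B)" by (simp add: ac_simps)
    then show "K ^ r \<le> real (card B)" using m K by (simp add: mult_le_cancel_left)
  next
    fix x y assume xy: "x \<in> B" "y \<in> B" "x \<noteq> y"
    have "split_coords lo hi (D - {c}) x y = split_coords lo hi D x y - {c}"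
      by (auto simp: split_coords_def)
    then have "card (split_coords lo hi D x y) \<le> Suc (card (split_coords lo hi (D - {c}) x y))"
      using diff_card_le_card_Diff[of "{c}" "split_coords lo hi D x y"] by simp
    moreover have "m + real (Suc r) \<le> real (card (split_coords lo hi D x y))"
      using xy B Suc.prems(5) by blast
    ultimately show "m + real r \<le> real (card (split_coords lo hi (D - {c}) x y))"
      by linarith
  qed
  define F where "F = {W. W \<subseteq> D - {c} \<and> shatters lo hi {x \<in> A. lo c x} W}"
  define G where "G = {W. W \<subseteq> D - {c} \<and> shatters lo hi {x \<in> A. hi c x} W}"
  have FG: "2 ^ r \<le> card F" "2 ^ r \<le> card G"
    unfolding F_def G_def by (intro step lo hi; auto)+
  have finFG: "finite F" "finite G" using Suc.prems(1) by (auto simp: F_def G_def)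
  \<comment> \<open>Members of \<open>F\<close> and \<open>G\<close> avoid \<open>c\<close>, so the
    sets \<open>insert c W\<close> with \<open>W\<close> in \<open>F \<inter> G\<close> are new and
    make up for the overlap.\<close>
  have "card F + card G = card (F \<union> G) + card (F \<inter> G)"
    by (rule card_Un_Int[OF finFG])
  also have "card (F \<inter> G) = card (insert c ` (F \<inter> G))"
    by (rule card_image[symmetric]) (auto simp: inj_on_def F_def G_def)
  also have "card (F \<union> G) + card (insert c ` (F \<inter> G)) = card (F \<union> G \<union> insert c ` (F \<inter> G))"
    using finFG by (subst card_Un_disjoint) (auto simp: F_def G_def)
  also have "\<dots> \<le> card {W. W \<subseteq> D \<and> shatters lo hi A W}"
  proof (rule card_mono)
    show "finite {W. W \<subseteq> D \<and> shatters lo hi A W}" using Suc.prems(1) by simp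
    show "F \<union> G \<union> insert c ` (F \<inter> G) \<subseteq> {W. W \<subseteq> D \<and> shatters lo hi A W}"
      using c by (auto simp: F_def G_def intro: shatters_insert
          shatters_mono[of lo hi "{x \<in> A. lo c x}"] shatters_mono[of lo hi "{x \<in> A. hi c x}"])
  qed
  finally show ?case using FG by simp
qed

section \<open>Affine systems\<close>

text \<open>An interval of length \<open>2 * \<eta>\<close> contains a full grid cell of length
  \<eta>, starting at \<open>a\<close> rounded up. The bound on \<open>j\<close> keeps the set of
  levels finite.\<close>

lemma exists_grid_gap:
  fixes a b M \<eta> :: real
  assumes "0 < \<eta>" and "\<bar>a\<bar> \<le> M" and "a + 2 * \<eta> \<le> b"
  obtains j :: int where "\<bar>j\<bar> \<le> \<lceil>M / \<eta>\<rceil>" and "a \<le> of_int j * \<eta>" and "of_int j * \<eta> + \<eta> \<le> b"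
proof -
  have "\<bar>\<lceil>a / \<eta>\<rceil>\<bar> \<le> \<lceil>M / \<eta>\<rceil>"
  proof -
    have "a / \<eta> \<le> M / \<eta>" "- (M / \<eta>) \<le> a / \<eta>"
      using assms by (auto simp: field_simps)
    then have "\<lceil>a / \<eta>\<rceil> \<le> \<lceil>M / \<eta>\<rceil>" "\<lceil>- (M / \<eta>)\<rceil> \<le> \<lceil>a / \<eta>\<rceil>"
      by (auto intro: ceiling_mono)
    then show ?thesis by linarith
  qed
  moreover have "a \<le> of_int \<lceil>a / \<eta>\<rceil> * \<eta>"
    using assms(1) by (simp add: pos_divide_le_eq[symmetric])
  moreover have "of_int \<lceil>a / \<eta>\<rceil> < a / \<eta> + 1" by linarith
  then have "of_int \<lceil>a / \<eta>\<rceil> * \<eta> < a + \<eta>" using assms(1) by (simp add: field_simps)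
  then have "of_int \<lceil>a / \<eta>\<rceil> * \<eta> + \<eta> \<le> b" using assms(3) by linarith
  ultimately show ?thesis by (rule that)
qed

text \<open>Convexity is expressed through the observables alone: a single \<open>z\<close>
  interpolates all of them at all times simultaneously. This combines the affinity of the
  observables with that of \<open>T\<close> and requires no vector space structure on the points.
  The axioms \<open>continuous\<close> and \<open>neighbourhood\<close> together say that the
  observables generate the topology.\<close>

locale affine_observables =
  fixes X :: "'b topology" and T :: "'b \<Rightarrow> 'b" and Obs :: "('b \<Rightarrow> real) set"
  assumes compact: "compact_space X"
    and maps: "x \<in> topspace X \<Longrightarrow> T x \<in> topspace X"
    and continuous: "f \<in> Obs \<Longrightarrow> continuous_map X euclideanreal f"
    and neighbourhood: "openin X U \<Longrightarrow> x \<in> U \<Longrightarrow>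
      \<exists>F e. finite F \<and> F \<subseteq> Obs \<and> 0 < e \<and>
        (\<forall>y\<in>topspace X. (\<forall>f\<in>F. \<bar>f x - f y\<bar> < e) \<longrightarrow> y \<in> U)"
    and convex: "x \<in> topspace X \<Longrightarrow> y \<in> topspace X \<Longrightarrow> 0 \<le> l \<Longrightarrow> l \<le> 1 \<Longrightarrow>
      \<exists>z\<in>topspace X. \<forall>f\<in>Obs. \<forall>i. f ((T ^^ i) z) = (1 - l) * f ((T ^^ i) x) + l * f ((T ^^ i) y)"
begin

lemma funpow_maps: "x \<in> topspace X \<Longrightarrow> (T ^^ n) x \<in> topspace X"
  by (induction n) (auto intro: maps)

lemma openin_near:
  assumes "finite F" and "F \<subseteq> Obs"
  shows "openin X {y \<in> topspace X. \<forall>f\<in>F. \<bar>f x - f y\<bar> < e}"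
proof -
  have iff: "\<bar>f x - f y\<bar> < e \<longleftrightarrow> f y \<in> {f x - e<..<f x + e}" for f and y :: 'b
    by auto
  have "openin X {y \<in> topspace X. f y \<in> {f x - e<..<f x + e}}" if "f \<in> F" for f
    using that assms continuous
    by (intro openin_continuous_map_preimage[where Y = euclideanreal]) auto
  then have "openin X (topspace X \<inter> (\<Inter>f\<in>F. {y \<in> topspace X. f y \<in> {f x - e<..<f x + e}}))"
    using assms(1) by (intro openin_INT2 openin_Int_Inter) auto
  also have "topspace X \<inter> (\<Inter>f\<in>F. {y \<in> topspace X. f y \<in> {f x - e<..<f x + e}})
      = {y \<in> topspace X. \<forall>f\<in>F. \<bar>f x - f y\<bar> < e}"
    unfolding iff by auto
  finally show ?thesis .
qed

lemma bounded_observable: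
  assumes "f \<in> Obs"
  shows "\<exists>M. \<forall>x\<in>topspace X. \<bar>f x\<bar> \<le> M"
proof -
  have "compactin euclideanreal (f ` topspace X)"
    using compact continuous[OF assms] by (intro image_compactin) (auto simp: compact_space_def)
  then have "bounded (f ` topspace X)" by (simp add: compact_imp_bounded)
  then show ?thesis by (auto simp: bounded_iff)
qed

text \<open>The Lebesgue number lemma for the pseudometrics given by finitely many observables;
  compactness merges the local families and radii into one.\<close>

lemma lebesgue_number:
  assumes "finite_open_cover X \<U>"
  obtains F e where "finite F" and "F \<subseteq> Obs" and "0 < e"
    and "\<And>x. x \<in> topspace X \<Longrightarrow>
      \<exists>U\<in>\<U>. \<forall>y\<in>topspace X. (\<forall>f\<in>F. \<bar>f x - f y\<bar> < e) \<longrightarrow> y \<in> U"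
proof -
  have "\<exists>U F e. U \<in> \<U> \<and> finite F \<and> F \<subseteq> Obs \<and> 0 < e \<and>
      (\<forall>y\<in>topspace X. (\<forall>f\<in>F. \<bar>f x - f y\<bar> < e) \<longrightarrow> y \<in> U)" if x: "x \<in> topspace X" for x
  proof -
    obtain U where "U \<in> \<U>" "x \<in> U" "openin X U"
      using assms x unfolding finite_open_cover_def by blast
    with neighbourhood[of U x] show ?thesis by blast
  qed
  then obtain U F e where UFe: "\<And>x. x \<in> topspace X \<Longrightarrow> U x \<in> \<U> \<and> finite (F x) \<and> F x \<subseteq> Obs \<and> 0 < e x \<and>
      (\<forall>y\<in>topspace X. (\<forall>f\<in>F x. \<bar>f x - f y\<bar> < e x) \<longrightarrow> y \<in> U x)"
    by metis
  \<comment> \<open>Half radii leave room for the triangle inequality through the chosen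
    center.\<close>
  define B where "B x = {y \<in> topspace X. \<forall>f\<in>F x. \<bar>f x - f y\<bar> < e x / 2}" for x
  have "\<exists>\<F>. finite \<F> \<and> \<F> \<subseteq> B ` topspace X \<and> topspace X \<subseteq> \<Union>\<F>"
  proof (rule compact[unfolded compact_space_alt, rule_format], intro conjI ballI)
    show "topspace X \<subseteq> \<Union>(B ` topspace X)" using UFe by (fastforce simp: B_def)
  next
    fix S assume "S \<in> B ` topspace X"
    then obtain x where "x \<in> topspace X" "S = B x" by blast
    then show "openin X S" using UFe openin_near[of "F x" x "e x / 2"] by (simp add: B_def)
  qed
  then obtain P where P: "finite P" "P \<subseteq> topspace X" "topspace X \<subseteq> \<Union>(B ` P)"
    by (auto dest: finite_subset_image)
  \<comment> \<open>The element 1 keeps \<open>Min\<close> meaningful when \<open>P\<close> is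
    empty.\<close>
  define e0 where "e0 = Min (insert 1 ((\<lambda>x. e x / 2) ` P))"
  show ?thesis
  proof (rule that)
    have "\<forall>p\<in>P. finite (F p) \<and> F p \<subseteq> Obs \<and> 0 < e p" using P(2) UFe by blast
    then show "finite (\<Union>(F ` P))" "\<Union>(F ` P) \<subseteq> Obs" "0 < e0"
      using P(1) by (auto simp: e0_def)
  next
    fix x assume x: "x \<in> topspace X"
    then obtain p where p: "p \<in> P" "x \<in> B p" using P by blast
    then have pt: "p \<in> topspace X" using P by blast
    have e0: "e0 \<le> e p / 2" unfolding e0_def using P p by (intro Min_le) auto
    have "y \<in> U p" if y: "y \<in> topspace X" "\<forall>f\<in>\<Union>(F ` P). \<bar>f x - f y\<bar> < e0" for y
    proof -
      have "\<bar>f p - f y\<bar> < e p" if f: "f \<in> F p" for f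
      proof -
        have "\<bar>f p - f x\<bar> < e p / 2" using p f by (auto simp: B_def)
        moreover have "\<bar>f x - f y\<bar> < e p / 2" using y p f e0 by fastforce
        ultimately show ?thesis by linarith
      qed
      then show ?thesis using UFe[OF pt] y by blast
    qed
    then show "\<exists>U\<in>\<U>. \<forall>y\<in>topspace X. (\<forall>f\<in>\<Union>(F ` P). \<bar>f x - f y\<bar> < e0) \<longrightarrow> y \<in> U"
      using UFe[OF pt] by blast
  qed
qed

lemma finite_cover_system: "finite_open_cover X \<U> \<Longrightarrow> finite_cover_system X T \<U>"
  using maps by (simp add: finite_cover_system_def finite_open_cover_def)

text \<open>The coordinates are made exact one at a time, for all patterns on the remaining ones at
  once. For a new \<open>k\<close>, take two points with the same pattern elsewhere, one high and
  one low at \<open>k\<close>; a suitable convex combination hits \<open>v k\<close>. Exact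
  coordinates survive since both points agree there, and the pattern survives since half-lines are
  convex.\<close>

lemma shattered_imp_realised:
  assumes f: "f \<in> Obs" and W: "finite W"
    and shat: "shatters (\<lambda>i x. f ((T ^^ i) x) \<le> s) (\<lambda>i x. t \<le> f ((T ^^ i) x)) (topspace X) W"
    and v: "\<And>i. i \<in> W \<Longrightarrow> s \<le> v i \<and> v i \<le> t"
  shows "\<exists>x\<in>topspace X. \<forall>i\<in>W. f ((T ^^ i) x) = v i"
proof -
  let ?f = "\<lambda>i x. f ((T ^^ i) x)"
  have "\<exists>x\<in>topspace X. (\<forall>i\<in>V. ?f i x = v i) \<and>
      (\<forall>i\<in>W - V. (i \<in> J \<longrightarrow> t \<le> ?f i x) \<and> (i \<notin> J \<longrightarrow> ?f i x \<le> s))"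
    if "V \<subseteq> W" for V J
    using finite_subset[OF that W] that
  proof (induction V arbitrary: J rule: finite_induct)
    case empty
    obtain x where "x \<in> topspace X"
      "\<forall>i\<in>W. (i \<in> J \<inter> W \<longrightarrow> t \<le> ?f i x) \<and> (i \<notin> J \<inter> W \<longrightarrow> ?f i x \<le> s)"
      using shat unfolding shatters_def by (metis Int_lower2)
    then show ?case by auto
  next
    case (insert k V)
    then have k: "k \<in> W" "k \<notin> V" and V: "V \<subseteq> W" by auto
    obtain x where x: "x \<in> topspace X" "\<forall>i\<in>V. ?f i x = v i"
      "\<forall>i\<in>W - V. (i \<in> insert k J \<longrightarrow> t \<le> ?f i x) \<and> (i \<notin> insert k J \<longrightarrow> ?f i x \<le> s)"
      using insert.IH[OF V] by blast
    obtain y where y: "y \<in> topspace X" "\<forall>i\<in>V. ?f i y = v i"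
      "\<forall>i\<in>W - V. (i \<in> J - {k} \<longrightarrow> t \<le> ?f i y) \<and> (i \<notin> J - {k} \<longrightarrow> ?f i y \<le> s)"
      using insert.IH[OF V] by blast
    have "?f k y \<le> v k" "v k \<le> ?f k x" using x(3) y(3) k v[of k] by force+
    then have "v k \<in> closed_segment (?f k y) (?f k x)" by (simp add: closed_segment_eq_real_ivl)
    then obtain l where l: "0 \<le> l" "l \<le> 1" "v k = (1 - l) * ?f k y + l * ?f k x"
      by (auto simp: in_segment)
    obtain z where z: "z \<in> topspace X" "\<And>i. ?f i z = (1 - l) * ?f i y + l * ?f i x"
      using convex[OF y(1) x(1) l(1,2)] f by blast
    have "?f i z = v i" if "i \<in> insert k V" for i
      using that x(2) y(2) l(3) z(2)[of i] by (auto simp: algebra_simps)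
    moreover have "(i \<in> J \<longrightarrow> t \<le> ?f i z) \<and> (i \<notin> J \<longrightarrow> ?f i z \<le> s)" if i: "i \<in> W - insert k V" for i
    proof -
      have "t = (1 - l) * t + l * t" "s = (1 - l) * s + l * s" by (auto simp: algebra_simps)
      moreover have "i \<in> W - V" "i \<noteq> k" using i by auto
      then have "i \<in> J \<Longrightarrow> t \<le> ?f i x \<and> t \<le> ?f i y" "i \<notin> J \<Longrightarrow> ?f i x \<le> s \<and> ?f i y \<le> s"
        using x(3) y(3) by auto
      then have "i \<in> J \<Longrightarrow> (1 - l) * t + l * t \<le> ?f i z" "i \<notin> J \<Longrightarrow> ?f i z \<le> (1 - l) * s + l * s"
        unfolding z(2) using l by (auto intro!: add_mono mult_left_mono)
      ultimately show ?thesis by simp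
    qed
    ultimately show ?case using z(1) by blast
  qed
  from this[of W "{}"] show ?thesis by auto
qed


section \<open>From positive entropy to shattered sets of times\<close>

definition shattered_at :: "('b \<Rightarrow> real) \<Rightarrow> real \<Rightarrow> real \<Rightarrow> nat set \<Rightarrow> bool" where
  "shattered_at f s t W \<longleftrightarrow>
     shatters (\<lambda>i x. f ((T ^^ i) x) \<le> s) (\<lambda>i x. t \<le> f ((T ^^ i) x)) (topspace X) W"

text \<open>Rounding the levels to a grid leaves finitely many pairs of observable and threshold,
  all with the same gap \<eta>. Finiteness is what later permits the pigeonhole principle to fix one
  pair.\<close>

lemma exists_finite_tests:
  assumes "finite F" and "F \<subseteq> Obs" and "0 < \<eta>"
  obtains Q where "finite Q" and "Q \<subseteq> Obs \<times> UNIV"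
    and "\<forall>f\<in>F. \<forall>x\<in>topspace X. \<forall>y\<in>topspace X. f x + 2 * \<eta> \<le> f y \<longrightarrow>
      (\<exists>s. (f, s) \<in> Q \<and> f x \<le> s \<and> s + \<eta> \<le> f y)"
proof -
  have "\<exists>M. \<forall>x\<in>topspace X. \<bar>f x\<bar> \<le> M" if "f \<in> F" for f
    using assms(2) that by (intro bounded_observable) auto
  then obtain M where M: "\<And>f x. f \<in> F \<Longrightarrow> x \<in> topspace X \<Longrightarrow> \<bar>f x\<bar> \<le> M f" by metis
  define Q where "Q = (SIGMA f:F. (\<lambda>j. of_int j * \<eta>) ` {- \<lceil>M f / \<eta>\<rceil>..\<lceil>M f / \<eta>\<rceil>})"
  show ?thesis
  proof (rule that)
    show "finite Q" using assms by (auto simp: Q_def)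
    show "Q \<subseteq> Obs \<times> UNIV" using assms by (auto simp: Q_def)
  next
    show "\<forall>f\<in>F. \<forall>x\<in>topspace X. \<forall>y\<in>topspace X. f x + 2 * \<eta> \<le> f y \<longrightarrow>
        (\<exists>s. (f, s) \<in> Q \<and> f x \<le> s \<and> s + \<eta> \<le> f y)"
    proof (intro ballI impI)
      fix f x y assume *: "f \<in> F" "x \<in> topspace X" "y \<in> topspace X" "f x + 2 * \<eta> \<le> f y"
      obtain j where j: "\<bar>j\<bar> \<le> \<lceil>M f / \<eta>\<rceil>" "f x \<le> of_int j * \<eta>" "of_int j * \<eta> + \<eta> \<le> f y"
        by (rule exists_grid_gap[OF assms(3) M[OF *(1,2)] *(4)])
      then have "(f, of_int j * \<eta>) \<in> Q" using * by (auto simp: Q_def abs_le_iff)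
      with j show "\<exists>s. (f, s) \<in> Q \<and> f x \<le> s \<and> s + \<eta> \<le> f y" by blast
    qed
 qed
qed

text \<open>All constants precede \<open>n\<close>. Exceptions at \<open>g * n\<close> times cost
  \<open>exp (c / 4 * n)\<close>, and \<open>K ^ r\<close> costs at most as much; since
  \<open>N n\<close> eventually exceeds \<open>exp (c / 2 * n)\<close>, there remain
  \<open>K ^ r\<close> states separated at more than \<open>g * n\<close> times. This margin is used
  as \<open>m + r\<close> with \<open>m = g * n / 2\<close>. The pair \<open>(f, s)\<close> found
  may vary with \<open>n\<close>, hence the conclusion for infinitely many \<open>n\<close>
  only.\<close>

lemma positive_entropy_imp_shattered:
  assumes U: "finite_open_cover X \<U>" and ne: "topspace X \<noteq> {}" and pos: "0 < cover_entropy X T \<U>"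
  obtains f s t \<delta> where "f \<in> Obs" and "s < t" and "0 < \<delta>"
    and "\<exists>\<^sub>F n in sequentially. \<exists>W\<subseteq>{..<n}. \<delta> * real n \<le> real (card W) \<and> shattered_at f s t W"
proof -
  interpret finite_cover_system X T \<U> by (rule finite_cover_system[OF U])
  define c where "c = cover_entropy X T \<U>"
  have c: "0 < c" using pos by (simp add: c_def)
  obtain F e where F: "finite F" "F \<subseteq> Obs" and e: "0 < e"
    and leb: "\<And>x. x \<in> topspace X \<Longrightarrow>
      \<exists>U\<in>\<U>. \<forall>y\<in>topspace X. (\<forall>f\<in>F. \<bar>f x - f y\<bar> < e) \<longrightarrow> y \<in> U"
    by (rule lebesgue_number[OF U], rule that) blast+
  define near where "near x y \<longleftrightarrow> (\<forall>f\<in>F. \<bar>f x - f y\<bar> < e)" for x y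
  \<comment> \<open>Points that are not near differ by at least \<open>e = 2 * \<eta>\<close> in
    some observable, exactly the gap that a test detects.\<close>
  define \<eta> where "\<eta> = e / 2"
  have \<eta>: "0 < \<eta>" using e by (simp add: \<eta>_def)
  obtain Q where Q: "finite Q" "Q \<subseteq> Obs \<times> UNIV"
    and tests: "\<forall>f\<in>F. \<forall>x\<in>topspace X. \<forall>y\<in>topspace X. f x + 2 * \<eta> \<le> f y \<longrightarrow>
      (\<exists>s. (f, s) \<in> Q \<and> f x \<le> s \<and> s + \<eta> \<le> f y)"
    by (rule exists_finite_tests[OF F \<eta>])
  \<comment> \<open>A coordinate is a time together with a test; a state with value strictly between
    \<open>s\<close> and \<open>s + \<eta>\<close> is neither low nor high there.\<close>
  define lo where "lo = (\<lambda>(i :: nat, f :: 'b \<Rightarrow> real, s) x. f ((T ^^ i) x) \<le> s)"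
  define hi where "hi = (\<lambda>(i :: nat, f :: 'b \<Rightarrow> real, s) x. s + \<eta> \<le> f ((T ^^ i) x))"
  obtain g where g: "0 < g"
    and small: "\<And>I :: nat set. finite I \<Longrightarrow>
      (\<Sum>B | B \<subseteq> I \<and> real (card B) \<le> g * real (card I). real (card \<U>) ^ card B)
        \<le> exp (c / 4 * real (card I))"
    by (rule sum_small_subsets_le_exp[of "real (card \<U>)" "c / 4"]) (use c that in auto)
  \<comment> \<open>Makes \<open>4 * card C \<le> K * m\<close> for the \<open>n * card Q\<close>
    coordinates and \<open>m = g * n / 2\<close>; the summand 2 ensures
    \<open>ln K > 0\<close>.\<close>
  define K where "K = nat \<lceil>8 * real (card Q) / g\<rceil> + 2"
  have K: "2 \<le> real K" "8 * real (card Q) / g \<le> real K" unfolding K_def by linarith+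
  have lnK: "0 < ln (real K)" using K by simp
  define \<rho> where "\<rho> = min (g / 2) (c / (4 * ln (real K)))"
  have \<rho>: "0 < \<rho>" "\<rho> \<le> g / 2" "\<rho> * ln (real K) \<le> c / 4"
    using g c lnK by (auto simp: \<rho>_def min_def field_simps)
  \<comment> \<open>With this rate the small subsets of the \<open>n * card Q\<close> coordinates
    number at most 2 to the power \<open>\<rho> * n / 2\<close>; adding 1 avoids division by
    0.\<close>
  have Qpos: "0 < \<rho> * ln 2 / (2 * (real (card Q) + 1))" using \<rho> by (simp add: add_nonneg_pos)
  obtain \<delta> where \<delta>: "0 < \<delta>"
    and count: "\<And>C :: (nat \<times> ('b \<Rightarrow> real) \<times> real) set. finite C \<Longrightarrow>
      (\<Sum>W | W \<subseteq> C \<and> real (card W) \<le> \<delta> * real (card C). (1::real) ^ card W)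
        \<le> exp (\<rho> * ln 2 / (2 * (real (card Q) + 1)) * real (card C))"
    by (rule sum_small_subsets_le_exp[of 1 "\<rho> * ln 2 / (2 * (real (card Q) + 1))"]) (use Qpos that in auto)
  have shattered: "\<exists>q\<in>Q. \<exists>W\<subseteq>{..<n}. \<delta> * real n \<le> real (card W) \<and>
      shattered_at (fst q) (snd q) (snd q + \<eta>) W"
    \<comment> \<open>The bound on \<open>n\<close> makes \<open>\<rho> * n / 2 > 1\<close>, so that
      rounding down still leaves \<open>r > \<rho> * n / 2\<close>.\<close>
    if n: "2 / \<rho> < real n" and N: "c / 2 < ln (real (N n)) / real n" for n
  proof -
    have n0: "0 < real n" using n \<rho> by (meson divide_pos_pos less_trans zero_less_numeral)
    have "ln (real (N n)) > c / 2 * real n" using N n0 by (simp add: field_simps)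
    moreover have Npos: "0 < N n"
      by (intro cover_number_pos iterated_join_finite finite_cover Union_iterated_join ne)
    ultimately have Nexp: "exp (c / 2 * real n) < real (N n)"
      by (metis exp_less_cancel_iff exp_ln of_nat_0_less_iff)
    define r where "r = nat \<lfloor>\<rho> * real n\<rfloor>"
    have "0 \<le> \<rho> * real n" using \<rho> by simp
    then have r: "real r \<le> \<rho> * real n" "\<rho> * real n - 1 < real r" unfolding r_def by linarith+
    have "real (K ^ r) = exp (real r * ln (real K))" using K by (simp add: exp_of_nat_mult)
    also have "\<dots> \<le> exp (c / 4 * real n)"
    proof -
      have "real r * ln (real K) \<le> \<rho> * real n * ln (real K)"
        using r lnK by (intro mult_right_mono) auto
      also have "\<dots> \<le> c / 4 * real n"
        using mult_right_mono[OF \<rho>(3), of "real n"] by (simp add: ac_simps)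
      finally show ?thesis by simp
    qed
    finally have Kr: "real (K ^ r) \<le> exp (c / 4 * real n)" .
    let ?S = "\<Sum>B | B \<subseteq> {..<n} \<and> real (card B) \<le> g * real n. card \<U> ^ card B"
    have "real (K ^ r * ?S) \<le> exp (c / 4 * real n) * exp (c / 4 * real n)"
      using Kr small[of "{..<n}"] unfolding of_nat_mult by (intro mult_mono) (auto intro: sum_nonneg)
    also have "\<dots> = exp (c / 2 * real n)" by (simp flip: exp_add)
    finally have "K ^ r * ?S < N n" using Nexp by linarith
    then obtain A where A: "A \<subseteq> topspace X" "finite A" "card A = K ^ r"
      and sep: "\<And>x y. x \<in> A \<Longrightarrow> y \<in> A \<Longrightarrow> x \<noteq> y \<Longrightarrow>
        g * real n < real (card {i. i < n \<and> \<not> near ((T ^^ i) x) ((T ^^ i) y)})"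
    proof -
      have "\<exists>A. A \<subseteq> topspace X \<and> finite A \<and> card A = K ^ r \<and> (\<forall>x\<in>A. \<forall>y\<in>A. x \<noteq> y \<longrightarrow>
          g * real n < real (card {i. i < n \<and> \<not> near ((T ^^ i) x) ((T ^^ i) y)}))"
      proof (rule exists_separated)
        show "\<exists>U\<in>\<U>. \<forall>x\<in>topspace X. near y x \<longrightarrow> x \<in> U" if "y \<in> topspace X" for y
          using leb[OF that] by (simp add: near_def)
        show "near x y" if "near y x" for x y
          using that by (simp add: near_def abs_minus_commute)
      qed (use \<open>K ^ r * ?S < N n\<close> e g in \<open>auto simp: near_def\<close>)
      then show ?thesis using that by blast
    qed
    define C where "C = {..<n} \<times> Q"
    have C: "finite C" "real (card C) = real n * real (card Q)"
      using Q by (simp_all add: C_def card_cartesian_product)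
    have "2 ^ r \<le> card {W. W \<subseteq> C \<and> shatters lo hi A W}"
    proof (rule card_shattered_ge[where m = "g * real n / 2" and K = "real K"])
      show "finite C" "finite A" "0 < g * real n / 2" "2 \<le> real K"
        using C A g n0 K by auto
      have "4 * real (card C) = 8 * real (card Q) / g * (g * real n / 2)"
        using g by (simp add: C field_simps)
      also have "\<dots> \<le> real K * (g * real n / 2)"
        using K g by (intro mult_right_mono) auto
      finally show "4 * real (card C) \<le> real K * (g * real n / 2)" .
      show "real K ^ r \<le> real (card A)" using A by simp
    next
      fix x y assume xy: "x \<in> A" "y \<in> A" "x \<noteq> y"
      let ?D = "{i. i < n \<and> \<not> near ((T ^^ i) x) ((T ^^ i) y)}"
      have "\<exists>q. (i, q) \<in> split_coords lo hi C x y" if i: "i \<in> ?D" for i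
      proof -
        obtain f where f: "f \<in> F" "e \<le> \<bar>f ((T ^^ i) x) - f ((T ^^ i) y)\<bar>"
          using i by (auto simp: near_def not_less)
        have "(T ^^ i) x \<in> topspace X" "(T ^^ i) y \<in> topspace X" using xy A funpow_maps by auto
        moreover have "f ((T ^^ i) x) + 2 * \<eta> \<le> f ((T ^^ i) y) \<or> f ((T ^^ i) y) + 2 * \<eta> \<le> f ((T ^^ i) x)"
          using f(2) unfolding \<eta>_def by linarith
        ultimately have "\<exists>s. (f, s) \<in> Q \<and>
            (f ((T ^^ i) x) \<le> s \<and> s + \<eta> \<le> f ((T ^^ i) y) \<or> f ((T ^^ i) y) \<le> s \<and> s + \<eta> \<le> f ((T ^^ i) x))"
          using tests f(1) by meson
        then show ?thesis using i by (auto simp: split_coords_def C_def lo_def hi_def)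
      qed
      \<comment> \<open>Every time of separation contributes at least one split coordinate, so
        separation in time passes to separation in coordinates.\<close>
      then have "?D \<subseteq> fst ` split_coords lo hi C x y" by force
      moreover have "finite (split_coords lo hi C x y)"
        using C by (simp add: split_coords_def)
      ultimately have "card ?D \<le> card (split_coords lo hi C x y)" by (meson surj_card_le)
      moreover have "g * real n < real (card ?D)" by (rule sep[OF xy])
      moreover have "real r \<le> g * real n / 2"
        using r mult_right_mono[OF \<rho>(2), of "real n"] by simp
      ultimately show "g * real n / 2 + real r \<le> real (card (split_coords lo hi C x y))"
        by linarith
    qed
    have "\<exists>W\<subseteq>C. shatters lo hi A W \<and> \<delta> * real (card C) < real (card W)"
    proof (rule ccontr)
      assume "\<not> ?thesis"
      then have "{W. W \<subseteq> C \<and> shatters lo hi A W} \<subseteq> {W. W \<subseteq> C \<and> real (card W) \<le> \<delta> * real (card C)}"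
        by (auto simp: not_less)
      then have "card {W. W \<subseteq> C \<and> shatters lo hi A W} \<le> card {W. W \<subseteq> C \<and> real (card W) \<le> \<delta> * real (card C)}"
        using C by (intro card_mono) auto
      with \<open>2 ^ r \<le> card {W. W \<subseteq> C \<and> shatters lo hi A W}\<close>
      have "real (2 ^ r) \<le> real (card {W. W \<subseteq> C \<and> real (card W) \<le> \<delta> * real (card C)})"
        unfolding of_nat_le_iff by (rule le_trans)
      also have "\<dots> \<le> exp (\<rho> * ln 2 / (2 * (real (card Q) + 1)) * real (card C))"
        using count[OF C(1)] by simp
      also have "\<dots> \<le> exp (\<rho> * real n / 2 * ln 2)"
      proof -
        have "real (card Q) / (real (card Q) + 1) \<le> 1" by simp
        then have "\<rho> * ln 2 / 2 * real n * (real (card Q) / (real (card Q) + 1)) \<le> \<rho> * ln 2 / 2 * real n * 1"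
          using \<rho> by (intro mult_left_mono) auto
        then show ?thesis by (simp add: C field_simps)
      qed
      also have "\<dots> < exp (real r * ln 2)"
      proof -
        have "1 < \<rho> * real n / 2" using n \<rho> by (simp add: field_simps)
        then have "\<rho> * real n / 2 < real r" using r by linarith
        then show ?thesis by simp
      qed
      also have "\<dots> = real (2 ^ r)" by (simp add: exp_of_nat_mult)
      finally show False by simp
    qed
    then obtain W where W: "W \<subseteq> C" "shatters lo hi A W" "\<delta> * real (card C) < real (card W)"
      by blast
    define Wq where "Wq q = {i. (i, q) \<in> W}" for q
    have Wq: "Wq q \<subseteq> {..<n}" for q using W by (auto simp: Wq_def C_def)
    then have finWq: "finite (Wq q)" for q by (rule finite_subset) simp
    \<comment> \<open>Pigeonhole over the tests: the sections of \<open>W\<close> have total size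
      above \<open>\<delta> * n * card Q\<close>.\<close>
    have "\<exists>q\<in>Q. \<delta> * real n < real (card (Wq q))"
    proof (rule ccontr)
      assume "\<not> ?thesis"
      then have "(\<Sum>q\<in>Q. real (card (Wq q))) \<le> (\<Sum>q\<in>Q. \<delta> * real n)"
        by (intro sum_mono) (auto simp: not_less)
      also have "\<dots> = \<delta> * real (card C)" by (simp add: C)
      finally have le: "(\<Sum>q\<in>Q. real (card (Wq q))) \<le> \<delta> * real (card C)" .
      have "card W \<le> card (SIGMA q:Q. Wq q)"
      proof (rule card_inj_on_le[where f = prod.swap])
        show "finite (SIGMA q:Q. Wq q)"
          using Q finWq by (intro finite_SigmaI)
      qed (use W in \<open>auto simp: inj_on_def Wq_def C_def\<close>)
      also have "\<dots> = (\<Sum>q\<in>Q. card (Wq q))"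
        using Q finWq by (intro card_SigmaI) auto
      finally have "real (card W) \<le> (\<Sum>q\<in>Q. real (card (Wq q)))"
        unfolding of_nat_sum[symmetric] of_nat_le_iff .
      with le W(3) show False by linarith
    qed
    then obtain q where q: "q \<in> Q" "\<delta> * real n < real (card (Wq q))" by blast
    have "shattered_at (fst q) (snd q) (snd q + \<eta>) (Wq q)"
      unfolding shattered_at_def shatters_def
    proof (intro allI impI)
      fix J assume "J \<subseteq> Wq q"
      \<comment> \<open>A pattern on the section is extended to \<open>W\<close> by requesting low
        at every other coordinate.\<close>
      then have "(\<lambda>i. (i, q)) ` J \<subseteq> W" by (auto simp: Wq_def)
      then obtain x where x: "x \<in> A"
        "\<forall>c\<in>W. (c \<in> (\<lambda>i. (i, q)) ` J \<longrightarrow> hi c x) \<and> (c \<notin> (\<lambda>i. (i, q)) ` J \<longrightarrow> lo c x)"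
        using W(2) unfolding shatters_def by blast
      have "(i \<in> J \<longrightarrow> hi (i, q) x) \<and> (i \<notin> J \<longrightarrow> lo (i, q) x)" if "i \<in> Wq q" for i
        using x(2) that by (auto simp: Wq_def)
      then show "\<exists>x\<in>topspace X. \<forall>i\<in>Wq q. (i \<in> J \<longrightarrow> snd q + \<eta> \<le> fst q ((T ^^ i) x)) \<and>
          (i \<notin> J \<longrightarrow> fst q ((T ^^ i) x) \<le> snd q)"
        using x(1) A(1) by (intro bexI[of _ x]) (auto simp: lo_def hi_def split_beta)
    qed
    with q Wq show ?thesis by (meson less_imp_le)
  qed
  have "\<forall>\<^sub>F n in sequentially. 2 / \<rho> < real n"
    by (rule eventually_compose_filterlim[OF eventually_gt_at_top filterlim_real_sequentially])
  moreover have "\<forall>\<^sub>F n in sequentially. c / 2 < ln (real (N n)) / real n"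
    using cover_entropy_tendsto[OF ne] c by (intro order_tendstoD(1)) (auto simp: c_def)
  ultimately have "\<forall>\<^sub>F n in sequentially. \<exists>q\<in>Q. \<exists>W\<subseteq>{..<n}. \<delta> * real n \<le> real (card W) \<and>
      shattered_at (fst q) (snd q) (snd q + \<eta>) W"
    by eventually_elim (rule shattered)
  \<comment> \<open>As \<open>Q\<close> is finite, one test serves infinitely many
    \<open>n\<close>.\<close>
  then have "\<exists>q\<in>Q. \<exists>\<^sub>F n in sequentially. \<exists>W\<subseteq>{..<n}. \<delta> * real n \<le> real (card W) \<and>
      shattered_at (fst q) (snd q) (snd q + \<eta>) W"
    by (intro frequently_bex_finite Q eventually_frequently) auto
  then obtain q where "q \<in> Q" "\<exists>\<^sub>F n in sequentially. \<exists>W\<subseteq>{..<n}. \<delta> * real n \<le> real (card W) \<and>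
      shattered_at (fst q) (snd q) (snd q + \<eta>) W" by blast
  with that[of "fst q" "snd q" "snd q + \<eta>" \<delta>] Q \<eta> \<delta> show ?thesis by auto
qed

section \<open>From shattered sets of times to infinite entropy\<close>

text \<open>The \<open>k + 1\<close> equally spaced levels from \<open>s\<close> to \<open>t\<close>
  can be prescribed freely along \<open>W\<close>. Different prescriptions differ by at least one
  spacing \<open>h\<close> at some time, whereas \<open>f\<close> varies by less than
  \<open>h\<close> on each cover element, so they need different cylinders.\<close>

lemma shattered_imp_large_entropy:
  assumes f: "f \<in> Obs" and st: "s < t" and \<delta>: "0 < \<delta>" and k: "0 < k" and ne: "topspace X \<noteq> {}"
    and freq: "\<exists>\<^sub>F n in sequentially. \<exists>W\<subseteq>{..<n}. \<delta> * real n \<le> real (card W) \<and> shattered_at f s t W"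
  obtains \<V> where "finite_open_cover X \<V>" and "\<delta> * ln (real k + 1) \<le> cover_entropy X T \<V>"
proof -
  define h where "h = (t - s) / real k"
  have h: "0 < h" "real k * h = t - s" using st k by (auto simp: h_def)
  define B where "B y = {x \<in> topspace X. \<forall>g\<in>{f}. \<bar>g y - g x\<bar> < h / 2}" for y
  have Bopen: "openin X (B y)" for y
    unfolding B_def using f by (intro openin_near) auto
  have "\<exists>\<F>. finite \<F> \<and> \<F> \<subseteq> B ` topspace X \<and> topspace X \<subseteq> \<Union>\<F>"
  proof (rule compact[unfolded compact_space_alt, rule_format], intro conjI ballI)
    show "topspace X \<subseteq> \<Union>(B ` topspace X)" using h by (fastforce simp: B_def)
    show "openin X S" if "S \<in> B ` topspace X" for S
      using that Bopen by blast
  qed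
  then obtain \<V> where V: "finite \<V>" "\<V> \<subseteq> B ` topspace X" "topspace X \<subseteq> \<Union>\<V>" by blast
  have close: "\<bar>f x - f y\<bar> < h" if U: "U \<in> \<V>" "x \<in> U" "y \<in> U" for U x y
  proof -
    obtain z where "U = B z" using V U by blast
    then have "\<bar>f z - f x\<bar> < h / 2" "\<bar>f z - f y\<bar> < h / 2" using U by (auto simp: B_def)
    then show ?thesis by linarith
  qed
  have V_cover: "finite_open_cover X \<V>"
    unfolding finite_open_cover_def
  proof (intro conjI ballI)
    show "openin X S" if "S \<in> \<V>" for S
      using that V Bopen by blast
    show "\<Union>\<V> = topspace X" using V by (auto simp: B_def)
  qed (rule V)
  interpret finite_cover_system X T \<V> by (rule finite_cover_system[OF V_cover])
  have lower: "\<delta> * ln (real k + 1) \<le> ln (real (N n)) / real n"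
    if n: "0 < n" and W: "W \<subseteq> {..<n}" "\<delta> * real n \<le> real (card W)" "shattered_at f s t W" for n W
  proof -
    have finW: "finite W" using W by (auto intro: finite_subset)
    have "\<exists>x\<in>topspace X. \<forall>i\<in>W. f ((T ^^ i) x) = s + real (u i) * h"
      if u: "u \<in> W \<rightarrow>\<^sub>E {..k}" for u
    proof (rule shattered_imp_realised[OF f finW W(3)[unfolded shattered_at_def]])
      fix i assume "i \<in> W"
      then have "real (u i) * h \<le> real k * h" using u h by (intro mult_right_mono) auto
      then show "s \<le> s + real (u i) * h \<and> s + real (u i) * h \<le> t" using h by auto
    qed
    then obtain x where x: "\<And>u. u \<in> W \<rightarrow>\<^sub>E {..k} \<Longrightarrow>
        x u \<in> topspace X \<and> (\<forall>i\<in>W. f ((T ^^ i) (x u)) = s + real (u i) * h)" by metis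
    obtain \<W> where sub: "\<W> \<subseteq> iterated_join X T \<V> n" "finite \<W>" "\<Union>\<W> = topspace X" "card \<W> = N n"
      by (rule cover_number_attained[OF iterated_join_finite[OF finite_cover] Union_iterated_join])
    have "\<exists>S\<in>\<W>. x u \<in> S" if "u \<in> W \<rightarrow>\<^sub>E {..k}" for u using x[OF that] sub by blast
    then obtain S where S: "\<And>u. u \<in> W \<rightarrow>\<^sub>E {..k} \<Longrightarrow> S u \<in> \<W> \<and> x u \<in> S u" by metis
    have "inj_on S (W \<rightarrow>\<^sub>E {..k})"
    proof (rule inj_onI)
      fix u v assume u: "u \<in> W \<rightarrow>\<^sub>E {..k}" and v: "v \<in> W \<rightarrow>\<^sub>E {..k}" and eq: "S u = S v"
      obtain w where w: "\<forall>i<n. w i \<in> \<V>" "S u = cylinder X T n w"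
        using S[OF u] sub by (auto simp: iterated_join_eq_cylinders)
      show "u = v"
      proof (rule PiE_ext[OF u v])
        fix i assume i: "i \<in> W"
        then have "i < n" using W by auto
        then have "(T ^^ i) (x u) \<in> w i" "(T ^^ i) (x v) \<in> w i" "w i \<in> \<V>"
          using S[OF u] S[OF v] eq w by (auto simp: cylinder_def)
        then have "\<bar>f ((T ^^ i) (x u)) - f ((T ^^ i) (x v))\<bar> < h" by (intro close)
        then have "\<bar>(real (u i) - real (v i)) * h\<bar> < 1 * h"
          using x[OF u] x[OF v] i by (simp add: algebra_simps)
        then have "\<bar>real (u i) - real (v i)\<bar> < 1" using h by (simp add: abs_mult)
        then show "u i = v i" by linarith
      qed
    qed
    moreover have "S ` (W \<rightarrow>\<^sub>E {..k}) \<subseteq> \<W>" using S by blast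
    ultimately have "card (W \<rightarrow>\<^sub>E {..k}) \<le> N n" using sub by (metis card_inj_on_le)
    then have "(k + 1) ^ card W \<le> N n" using finW by (simp add: card_PiE)
    then have pow: "(real k + 1) ^ card W \<le> real (N n)"
      by (metis of_nat_1 of_nat_add of_nat_le_iff of_nat_power)
    have "\<delta> * real n * ln (real k + 1) \<le> real (card W) * ln (real k + 1)"
      using W by (intro mult_right_mono) auto
    also have "\<dots> = ln ((real k + 1) ^ card W)" by (simp add: ln_realpow)
    also have "\<dots> \<le> ln (real (N n))" using pow by (intro ln_mono) (auto intro: less_le_trans[OF _ pow])
    finally show ?thesis using n by (simp add: field_simps)
  qed
  \<comment> \<open>Infinitely many \<open>n\<close> suffice because the sequence converges to the
    entropy.\<close>
  have "\<exists>\<^sub>F n in sequentially. \<delta> * ln (real k + 1) \<le> ln (real (N n)) / real n"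
    by (rule frequently_rev_mp[OF freq], rule eventually_mono[OF eventually_gt_at_top[of 0]])
      (use lower in blast)
  then have "\<not> (\<forall>\<^sub>F n in sequentially. ln (real (N n)) / real n < \<delta> * ln (real k + 1))"
    by (simp add: frequently_def not_le)
  then have "\<delta> * ln (real k + 1) \<le> cover_entropy X T \<V>"
    using order_tendstoD(2)[OF cover_entropy_tendsto[OF ne]] by (meson not_less)
  with V_cover show ?thesis by (rule that)
qed

lemma finite_open_cover_trivial: "finite_open_cover X {topspace X}"
  by (simp add: finite_open_cover_def)

lemma cover_entropy_nonneg:
  assumes "finite_open_cover X \<U>"
  shows "0 \<le> cover_entropy X T \<U>"
proof (cases "topspace X = {}")
  case True
  then show ?thesis by (simp add: cover_entropy_def cover_number_empty_space)
next
  case False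
  interpret finite_cover_system X T \<U> by (rule finite_cover_system[OF assms])
  have "0 < N n" for n
    by (intro cover_number_pos iterated_join_finite finite_cover Union_iterated_join False)
  then show ?thesis
    by (intro LIMSEQ_le_const[OF cover_entropy_tendsto[OF False]]) (auto simp: Suc_le_eq)
qed

theorem topological_entropy_0_or_infinity:
  "topological_entropy X T = 0 \<or> topological_entropy X T = \<infinity>"
proof (cases "\<exists>\<U>. finite_open_cover X \<U> \<and> 0 < cover_entropy X T \<U>")
  case False
  then have "cover_entropy X T \<U> = 0" if "finite_open_cover X \<U>" for \<U>
    using cover_entropy_nonneg[OF that] that by force
  then have "topological_entropy X T = (SUP \<U>\<in>{\<U>. finite_open_cover X \<U>}. ereal 0)"
    unfolding topological_entropy_def by (intro SUP_cong) auto
  \<comment> \<open>The trivial cover makes the index set nonempty; an empty supremum in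
    \<open>ereal\<close> would be minus infinity.\<close>
  also have "\<dots> = 0" using finite_open_cover_trivial by (subst SUP_const) auto
  finally show ?thesis ..
next
  case True
  then obtain \<U> where U: "finite_open_cover X \<U>" "0 < cover_entropy X T \<U>" by blast
  have ne: "topspace X \<noteq> {}"
    using U(2) by (auto simp: cover_entropy_def cover_number_empty_space)
  obtain f s t \<delta> where fst: "f \<in> Obs" "s < t" and \<delta>: "0 < \<delta>"
    and freq: "\<exists>\<^sub>F n in sequentially. \<exists>W\<subseteq>{..<n}. \<delta> * real n \<le> real (card W) \<and> shattered_at f s t W"
    by (rule positive_entropy_imp_shattered[OF U(1) ne U(2)])
  have "ereal (real m) \<le> topological_entropy X T" for m :: nat
  proof -
    \<comment> \<open>Possible because \<delta> was fixed beforehand: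
      \<open>\<delta> * ln (k + 1)\<close> is unbounded in \<open>k\<close>.\<close>
    obtain k :: nat where k: "exp (real m / \<delta>) < real k" using reals_Archimedean2 by blast
    have "0 < real k" using k by (meson exp_gt_zero less_trans)
    then have "0 < k" by simp
    obtain \<V> where V: "finite_open_cover X \<V>" "\<delta> * ln (real k + 1) \<le> cover_entropy X T \<V>"
      by (rule shattered_imp_large_entropy[OF fst \<delta> \<open>0 < k\<close> ne freq])
    have "real m / \<delta> \<le> ln (real k + 1)" using k by (subst ln_ge_iff) auto
    then have "real m \<le> \<delta> * ln (real k + 1)" using \<delta> by (simp add: field_simps)
    with V(2) have "ereal (real m) \<le> ereal (cover_entropy X T \<V>)" by simp
    also have "\<dots> \<le> topological_entropy X T"
      unfolding topological_entropy_def using V(1) by (intro SUP_upper) auto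
    finally show ?thesis .
  qed
  then have "topological_entropy X T = \<infinity>"
    by (metis ereal_top of_nat_le_iff ereal_less_eq(3) order_trans real_arch_simple)
  then show ?thesis ..
qed

end

section \<open>The state space is a compact convex system\<close>

text \<open>Consecutive coefficients have ratio \<open>(1/2 - n) / (n + 1)\<close>, of modulus at
  most 1. This lets a geometric series dominate the square root series.\<close>

lemma abs_gbinomial_half_le_1: "\<bar>(1/2 :: real) gchoose n\<bar> \<le> 1"
proof (induction n)
  case (Suc n)
  have "(1/2 :: real) gchoose Suc n = ((1/2) gchoose n) * ((1/2 - real n) / real (Suc n))"
    by (simp add: gbinomial_absorb_comp gbinomial_rec field_simps gbinomial_prod_rev)
  moreover have "\<bar>(1/2 - real n) / real (Suc n)\<bar> \<le> 1" by (simp add: divide_le_eq)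
  ultimately have "\<bar>(1/2 :: real) gchoose Suc n\<bar> \<le> 1 * 1"
    using Suc by (simp only: abs_mult) (intro mult_mono; simp)
  then show ?case by simp
qed simp

lemma star_scaleR: "star (r *\<^sub>R x) = r *\<^sub>R star x" for x :: "'a::cstar_algebra_1"
  by (simp add: star_scaleC flip: scaleC_of_real)

text \<open>The identity \<open>norm (star y * y) = (norm y)^2\<close> and submultiplicativity give
  \<open>norm y \<le> norm (star y)\<close>; involutivity gives the converse.\<close>

lemma norm_star: "norm (star x) = norm x" for x :: "'a::cstar_algebra_1"
proof -
  have le: "norm y \<le> norm (star y)" for y :: 'a
  proof (cases "y = 0")
    case False
    have "norm y * norm y \<le> norm (star y) * norm y"
      using norm_mult_ineq[of "star y" y] by (simp add: cstar_identity power2_eq_square)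
    then show ?thesis using False by simp
  qed simp
  show ?thesis using le[of x] le[of "star x"] by (simp add: star_star)
qed

lemma bounded_linear_star: "bounded_linear (star :: 'a::cstar_algebra_1 \<Rightarrow> 'a)"
  by (rule bounded_linear_intro[of _ 1]) (simp_all add: star_add star_scaleR norm_star)

lemma star_diff: "star (x - y) = star x - star y" for x y :: "'a::cstar_algebra_1"
  by (rule linear_diff[OF bounded_linear.linear[OF bounded_linear_star]])

lemma star_one: "star 1 = (1 :: 'a::cstar_algebra_1)"
  by (metis mult_1_left mult_1_right star_mult star_star)

lemma star_power: "star (x ^ n) = star x ^ n" for x :: "'a::cstar_algebra_1"
  by (induction n) (simp_all add: star_one star_mult power_commutes)

text \<open>Positivity of a functional speaks only of elements \<open>star y * y\<close>; this
  supplies enough of them without functional calculus.\<close>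

lemma one_minus_is_square:
  fixes h :: "'a::cstar_algebra_1"
  assumes sa: "star h = h" and h: "norm h < 1"
  obtains y where "star y * y = 1 - h"
proof -
  \<comment> \<open>\<open>y\<close> is the binomial series of the square root of \<open>1 - h\<close>\<close>
  define b where "b n = (-1) ^ n * ((1/2 :: real) gchoose n)" for n
  define a where "a n = b n *\<^sub>R h ^ n" for n
  have b: "\<bar>b n\<bar> \<le> 1" for n
    using abs_gbinomial_half_le_1[of n] by (simp add: b_def abs_mult power_abs)
  have le: "norm (a n) \<le> norm h ^ n" for n
  proof -
    have "norm (a n) \<le> 1 * norm h ^ n"
      unfolding a_def norm_scaleR using b by (intro mult_mono norm_power_ineq) auto
    then show ?thesis by simp
  qed
  have summ: "summable (\<lambda>n. norm (a n))"
  proof (rule summable_norm_comparison_test)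
    show "\<exists>N. \<forall>n\<ge>N. norm (a n) \<le> norm h ^ n" using le by blast
    show "summable (\<lambda>n. norm h ^ n)" using h by (intro summable_geometric) simp
  qed
  define y where "y = (\<Sum>n. a n)"
  have "star y = (\<Sum>n. star (a n))"
    unfolding y_def by (rule bounded_linear.suminf[OF bounded_linear_star summable_norm_cancel[OF summ]])
  also have "\<dots> = y" by (simp add: y_def a_def star_scaleR star_power sa)
  finally have "star y = y" .
  \<comment> \<open>By Vandermonde the convolution of the coefficients for exponent 1/2 is that for
    exponent 1, which vanishes for \<open>k > 1\<close>; hence the Cauchy product is
    \<open>1 - h\<close>.\<close>
  have conv: "(\<Sum>i\<le>k. a i * a (k - i)) = ((-1) ^ k * (1 gchoose k)) *\<^sub>R h ^ k" for k
  proof -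
    have "(\<Sum>i\<le>k. a i * a (k - i)) = (\<Sum>i\<le>k. b i * b (k - i)) *\<^sub>R h ^ k"
      by (simp add: a_def scaleR_sum_left mult.commute flip: power_add)
    also have "(\<Sum>i\<le>k. b i * b (k - i))
        = (-1) ^ k * (\<Sum>i\<in>{0..k}. ((1/2) gchoose i) * ((1/2) gchoose (k - i)))"
      unfolding sum_distrib_left atMost_atLeast0
    proof (rule sum.cong[OF refl])
      fix i assume "i \<in> {0..k}"
      then have "(-1 :: real) ^ k = (-1) ^ i * (-1) ^ (k - i)" by (simp flip: power_add)
      then show "b i * b (k - i) = (-1) ^ k * (((1/2) gchoose i) * ((1/2) gchoose (k - i)))"
        by (simp add: b_def)
    qed
    also have "(\<Sum>i\<in>{0..k}. ((1/2 :: real) gchoose i) * ((1/2) gchoose (k - i))) = 1 gchoose k"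
      using gbinomial_Vandermonde[of "1/2 :: real" "1/2" k] by simp
    finally show ?thesis .
  qed
  have zero: "(1 :: real) gchoose k = 0" if "k \<notin> {..1}" for k
    using that binomial_gbinomial[of 1 k, where 'a = real] by (simp add: binomial_eq_0)
  have "y * y = (\<Sum>k. \<Sum>i\<le>k. a i * a (k - i))"
    unfolding y_def by (rule Cauchy_product[OF summ summ])
  also have "\<dots> = (\<Sum>k\<in>{..1}. ((-1) ^ k * (1 gchoose k)) *\<^sub>R h ^ k)"
    unfolding conv by (rule suminf_finite) (simp_all add: zero)
  also have "\<dots> = 1 - h" by simp
  finally have "star y * y = 1 - h" using \<open>star y = y\<close> by simp
  then show ?thesis by (rule that)
qed

text \<open>With \<open>K = norm h + 1\<close> both \<open>1 + h / K\<close> and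
  \<open>1 - h / K\<close> have the form \<open>star y * y\<close>. A state is nonnegative on both,
  which makes its value at \<open>h\<close> real and of modulus at most \<open>K\<close>. The added
  1 gives the strict inequality for the square root and covers \<open>h = 0\<close>.\<close>

lemma state_self_adjoint_bound:
  assumes phi: "\<phi> \<in> states" and sa: "star h = h"
  shows "cmod (\<phi> h) \<le> norm h + 1"
proof -
  have add: "\<phi> (x + y) = \<phi> x + \<phi> y" and scale: "\<phi> (c *\<^sub>C x) = c * \<phi> x" and one: "\<phi> 1 = 1"
    and pos: "\<phi> (star x * x) \<in> \<real>\<^sub>\<ge>\<^sub>0" for x y c
    using phi by (auto simp: states_def positive_functional_def linear_functional_def)
  have scaleR: "\<phi> (r *\<^sub>R x) = of_real r * \<phi> x" for r x
    using scale[of "of_real r" x] by (simp add: scaleC_of_real)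
  define K where "K = norm h + 1"
  have K: "0 < K" by (simp add: K_def add_nonneg_pos)
  have pos': "1 + of_real s * \<phi> h \<in> \<real>\<^sub>\<ge>\<^sub>0" if s: "\<bar>s\<bar> = 1 / K" for s
  proof -
    have "norm ((- s) *\<^sub>R h) = norm h / K" using s by simp
    also have "\<dots> < 1" using K by (simp add: K_def)
    finally have "norm ((- s) *\<^sub>R h) < 1" .
    moreover have "star ((- s) *\<^sub>R h) = (- s) *\<^sub>R h" by (simp only: star_scaleR sa)
    ultimately obtain y where y: "star y * y = 1 - (- s) *\<^sub>R h"
      using one_minus_is_square[of "(- s) *\<^sub>R h"] by metis
    then have "\<phi> (star y * y) = 1 + of_real s * \<phi> h"
      using add[of 1 "s *\<^sub>R h"] by (simp add: one scaleR)
    then show ?thesis using pos[of y] by simp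
  qed
  have "1 + of_real (1 / K) * \<phi> h \<in> \<real>\<^sub>\<ge>\<^sub>0" "1 + of_real (- 1 / K) * \<phi> h \<in> \<real>\<^sub>\<ge>\<^sub>0"
    using K by (intro pos'; simp)+
  then have "Im (\<phi> h) = 0" "\<bar>Re (\<phi> h)\<bar> \<le> K"
    using K by (auto simp: complex_nonneg_Reals_iff field_simps abs_le_iff)
  then show ?thesis by (simp add: cmod_def K_def)
qed

text \<open>Split \<open>x = h + \<i> *\<^sub>C k\<close> into self-adjoint parts. The sharp bound
  is \<open>norm x\<close>, but compactness asks only for some bound at each \<open>x\<close> common
  to all states.\<close>

lemma state_bound:
  assumes phi: "\<phi> \<in> states"
  shows "cmod (\<phi> x) \<le> 2 * (norm x + 1)"
proof -
  have add: "\<phi> (x + y) = \<phi> x + \<phi> y" and scale: "\<phi> (c *\<^sub>C x) = c * \<phi> x" for x y c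
    using phi by (auto simp: states_def positive_functional_def linear_functional_def)
  define h where "h = (1/2) *\<^sub>R (x + star x)"
  define k where "k = (- \<i> / 2) *\<^sub>C (x - star x)"
  have "star h = h"
    by (simp add: h_def star_scaleR star_add star_star add.commute)
  moreover have "star k = k"
  proof -
    have "star k = (\<i> / 2) *\<^sub>C (star x - x)"
      by (simp add: k_def star_scaleC star_diff star_star)
    also have "star x - x = (-1) *\<^sub>C (x - star x)"
      using scaleC_of_real[of "-1" "x - star x"] by simp
    finally show ?thesis by (simp add: k_def scaleC_scaleC)
  qed
  moreover have "h + \<i> *\<^sub>C k = x"
  proof -
    have "\<i> *\<^sub>C k = complex_of_real (1/2) *\<^sub>C (x - star x)"
      by (simp add: k_def scaleC_scaleC)
    also have "\<dots> = (1/2) *\<^sub>R (x - star x)" by (rule scaleC_of_real)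
    finally have "h + \<i> *\<^sub>C k = (1/2) *\<^sub>R (x + star x) + (1/2) *\<^sub>R (x - star x)"
      by (simp add: h_def)
    also have "\<dots> = (1/2) *\<^sub>R ((x + star x) + (x - star x))"
      by (rule scaleR_add_right[symmetric])
    also have "\<dots> = x" by (simp flip: scaleR_2)
    finally show ?thesis .
  qed
  moreover have "norm h \<le> norm x" "norm k \<le> norm x"
  proof -
    show "norm h \<le> norm x"
      using norm_triangle_ineq[of x "star x"] by (simp add: h_def norm_star)
    show "norm k \<le> norm x"
      using norm_triangle_ineq4[of x "star x"] by (simp add: k_def norm_star norm_scaleC norm_divide)
  qed
  ultimately have "cmod (\<phi> x) \<le> cmod (\<phi> h) + cmod (\<phi> k)"
    using add[of h "\<i> *\<^sub>C k"] norm_triangle_ineq[of "\<phi> h" "\<i> * \<phi> k"] by (simp add: scale norm_mult)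
  also have "\<dots> \<le> (norm h + 1) + (norm k + 1)"
    using phi \<open>star h = h\<close> \<open>star k = k\<close> by (intro add_mono state_self_adjoint_bound)
  also have "\<dots> \<le> 2 * (norm x + 1)"
    using \<open>norm h \<le> norm x\<close> \<open>norm k \<le> norm x\<close> by simp
  finally show ?thesis .
qed

section \<open>Compactness, convexity and the action of the automorphism\<close>

text \<open>Each defining condition is closed and involves finitely many evaluations, which are
  continuous for pointwise convergence.\<close>

lemma closed_states: "closed (states :: ('a::cstar_algebra_1 \<Rightarrow> complex) set)"
proof -
  have "closed {\<phi> :: 'a \<Rightarrow> complex. \<phi> x \<in> \<real>\<^sub>\<ge>\<^sub>0}" for x
    using closed_vimage[OF closed_nonneg_Reals_complex continuous_on_product_coordinates[of x]]
    by (simp add: vimage_def)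
  then show ?thesis
    unfolding states_def positive_functional_def linear_functional_def
    by (intro closed_Collect_conj closed_Collect_all closed_Collect_eq
        continuous_intros continuous_on_product_coordinates)
qed

text \<open>The Banach-Alaoglu argument: \<open>states\<close> is closed inside a product of discs,
  which is compact by Tychonoff.\<close>

lemma compact_space_state_space: "compact_space (state_space :: ('a::cstar_algebra_1 \<Rightarrow> complex) topology)"
proof -
  let ?P = "product_topology (\<lambda>_::'a. euclidean :: complex topology) UNIV"
  have "compactin ?P (PiE UNIV (\<lambda>x. cball 0 (2 * (norm x + 1))))"
    by (simp add: compactin_PiE)
  moreover have "states \<subseteq> PiE UNIV (\<lambda>x::'a. cball 0 (2 * (norm x + 1)))"
    using state_bound by auto
  moreover have "closedin ?P states"
    using closed_states by (simp add: euclidean_product_topology)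
  ultimately have "compactin ?P states" by (rule closed_compactin)
  then show ?thesis
    unfolding state_space_def by (rule compact_space_subtopology)
qed

lemma topspace_state_space: "topspace state_space = states"
  by (simp add: state_space_def)

lemma states_convex:
  assumes "\<sigma> \<in> states" and "\<tau> \<in> states" and "0 \<le> l" and "l \<le> 1"
  shows "(\<lambda>x. of_real (1 - l) * \<sigma> x + of_real l * \<tau> x) \<in> states"
proof -
  have "of_real (1 - l) \<in> (\<real>\<^sub>\<ge>\<^sub>0 :: complex set)" "of_real l \<in> (\<real>\<^sub>\<ge>\<^sub>0 :: complex set)"
    using assms(3,4) by (simp_all only: nonneg_Reals_of_real_iff)
  moreover have "of_real (1 - l) + of_real l = (1 :: complex)" by simp
  ultimately show ?thesis
    using assms(1,2) unfolding states_def positive_functional_def linear_functional_def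
    by (auto simp: algebra_simps simp del: of_real_diff intro!: nonneg_Reals_add_I nonneg_Reals_mult_I)
qed

text \<open>By surjectivity \<open>\<alpha> 1\<close> acts as a left unit on a preimage image: with
  \<open>\<alpha> e = 1\<close>, multiplicativity turns \<open>\<alpha> 1 * \<alpha> e\<close> back
  into \<open>\<alpha> e\<close>.\<close>

lemma cstar_automorphism_one:
  assumes "cstar_automorphism \<alpha>"
  shows "\<alpha> 1 = 1"
proof -
  obtain e where e: "\<alpha> e = 1"
    using assms unfolding cstar_automorphism_def by (metis bij_pointE)
  have "\<alpha> 1 = \<alpha> 1 * \<alpha> e" by (simp add: e)
  also have "\<dots> = \<alpha> (1 * e)" using assms unfolding cstar_automorphism_def by metis
  also have "\<dots> = 1" by (simp add: e)
  finally show ?thesis .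
qed

lemma states_comp_automorphism:
  assumes "cstar_automorphism \<alpha>" and "\<sigma> \<in> states"
  shows "\<sigma> \<circ> \<alpha> \<in> states"
proof -
  have "\<sigma> (\<alpha> (star x * x)) \<in> \<real>\<^sub>\<ge>\<^sub>0" for x
  proof -
    have "\<alpha> (star x * x) = star (\<alpha> x) * \<alpha> x"
      using assms(1) by (simp add: cstar_automorphism_def)
    then show ?thesis
      using assms(2) by (simp add: states_def positive_functional_def)
  qed
  then show ?thesis
    using assms by (auto simp: states_def positive_functional_def linear_functional_def
        cstar_automorphism_def cstar_automorphism_one[OF assms(1)])
qed

text \<open>A basic neighbourhood restricts finitely many complex values. Real parts control them:
  by complex linearity of states, the imaginary part at \<open>a\<close> is the real part at
  \<open>(- \<i>) *\<^sub>C a\<close>.\<close>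

lemma state_space_neighbourhood:
  assumes "openin state_space U" and "\<sigma> \<in> U"
  shows "\<exists>F e. finite F \<and> F \<subseteq> range (\<lambda>a \<phi>. Re (\<phi> a)) \<and> 0 < e \<and>
    (\<forall>\<tau>\<in>states. (\<forall>f\<in>F. \<bar>f \<sigma> - f \<tau>\<bar> < e) \<longrightarrow> \<tau> \<in> U)"
proof -
  obtain V where V: "openin (product_topology (\<lambda>_. euclidean) UNIV) V" "U = V \<inter> states"
    using assms(1) unfolding state_space_def openin_subtopology by blast
  obtain B where B: "\<sigma> \<in> PiE UNIV B" "\<And>a. openin euclidean (B a)"
    "finite {a. B a \<noteq> topspace euclidean}" "PiE UNIV B \<subseteq> V"
    using product_topology_open_contains_basis[OF V(1), of \<sigma>] assms(2) V(2) by auto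
  define J where "J = {a. B a \<noteq> UNIV}"
  have J: "finite J" using B(3) by (simp add: J_def)
  have "\<exists>r>0. ball (\<sigma> a) r \<subseteq> B a" for a
    using B(1,2) by (intro open_contains_ball_eq[THEN iffD1, rule_format]) (auto simp: PiE_def)
  then obtain r where r: "\<And>a. 0 < r a" "\<And>a. ball (\<sigma> a) (r a) \<subseteq> B a" by metis
  \<comment> \<open>Halved because the modulus is bounded by the sum of the real and imaginary
    deviations; the element 1 covers an empty \<open>J\<close>.\<close>
  define e where "e = Min (insert 1 (r ` J)) / 2"
  have e: "0 < e" using J r by (simp add: e_def)
  have e_le: "2 * e \<le> r a" if "a \<in> J" for a
    using J that by (simp add: e_def)
  define F where "F = (\<lambda>a \<phi>. Re (\<phi> a)) ` (J \<union> (\<lambda>a. (- \<i>) *\<^sub>C a) ` J)"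
  have "\<tau> \<in> U" if \<tau>: "\<tau> \<in> states" "\<forall>f\<in>F. \<bar>f \<sigma> - f \<tau>\<bar> < e" for \<tau>
  proof -
    have "\<tau> a \<in> B a" for a
    proof (cases "a \<in> J")
      case True
      have "\<bar>Re (\<sigma> a) - Re (\<tau> a)\<bar> < e"
        "\<bar>Re (\<sigma> ((- \<i>) *\<^sub>C a)) - Re (\<tau> ((- \<i>) *\<^sub>C a))\<bar> < e"
        using \<tau>(2) True by (auto simp: F_def)
      moreover have "\<sigma> ((- \<i>) *\<^sub>C a) = (- \<i>) * \<sigma> a" "\<tau> ((- \<i>) *\<^sub>C a) = (- \<i>) * \<tau> a"
        using assms(2) V(2) \<tau>(1)
        by (simp_all add: states_def positive_functional_def linear_functional_def)
      ultimately have "\<bar>Re (\<sigma> a - \<tau> a)\<bar> + \<bar>Im (\<sigma> a - \<tau> a)\<bar> < 2 * e" by simp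
      then have "dist (\<sigma> a) (\<tau> a) < r a"
        using cmod_le[of "\<sigma> a - \<tau> a"] e_le[OF True] unfolding dist_norm by linarith
      then show ?thesis using r(2)[of a] by auto
    qed (simp add: J_def)
    then show ?thesis using B(4) \<tau>(1) V(2) by auto
  qed
  then show ?thesis
    using J e by (intro exI[of _ F] exI[of _ e]) (auto simp: F_def)
qed

lemma funpow_comp_right:
  fixes \<alpha> :: "'a \<Rightarrow> 'a"
  shows "((\<lambda>\<sigma>. \<sigma> \<circ> \<alpha>) ^^ n) \<sigma> = \<sigma> \<circ> (\<alpha> ^^ n)"
proof (induction n)
  case (Suc n)
  then have "((\<lambda>\<sigma>. \<sigma> \<circ> \<alpha>) ^^ Suc n) \<sigma> = (\<sigma> \<circ> (\<alpha> ^^ n)) \<circ> \<alpha>"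
    by (simp only: funpow.simps o_apply[of "\<lambda>\<sigma>. \<sigma> \<circ> \<alpha>"])
  then show ?case by (simp only: funpow_Suc_right o_assoc)
qed simp

lemma affine_observables_state_space:
  assumes "cstar_automorphism (\<alpha> :: 'a::cstar_algebra_1 \<Rightarrow> 'a)"
  shows "affine_observables state_space (\<lambda>\<sigma>. \<sigma> \<circ> \<alpha>) (range (\<lambda>a \<phi>. Re (\<phi> a)))"
proof unfold_locales
  show "compact_space (state_space :: ('a \<Rightarrow> complex) topology)"
    by (rule compact_space_state_space)
next
  fix \<sigma> :: "'a \<Rightarrow> complex" assume "\<sigma> \<in> topspace state_space"
  then show "\<sigma> \<circ> \<alpha> \<in> topspace state_space"
    using states_comp_automorphism[OF assms] by (simp add: topspace_state_space)
next
  fix f :: "('a \<Rightarrow> complex) \<Rightarrow> real" assume "f \<in> range (\<lambda>a \<phi>. Re (\<phi> a))"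
  then obtain a where f: "f = (\<lambda>\<phi>. Re (\<phi> a))" by blast
  have "continuous_on UNIV f"
    unfolding f by (intro continuous_on_Re continuous_on_product_coordinates)
  then show "continuous_map state_space euclideanreal f"
    unfolding state_space_def euclidean_product_topology
    by (intro continuous_map_from_subtopology) (simp add: continuous_map_iff_continuous2)
next
  fix U :: "('a \<Rightarrow> complex) set" and \<sigma> assume "openin state_space U" "\<sigma> \<in> U"
  then show "\<exists>F e. finite F \<and> F \<subseteq> range (\<lambda>a \<phi>. Re (\<phi> a)) \<and> 0 < e \<and>
      (\<forall>\<tau>\<in>topspace state_space. (\<forall>f\<in>F. \<bar>f \<sigma> - f \<tau>\<bar> < e) \<longrightarrow> \<tau> \<in> U)"
    unfolding topspace_state_space by (rule state_space_neighbourhood)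
next
  fix \<sigma> \<tau> :: "'a \<Rightarrow> complex" and l :: real
  assume *: "\<sigma> \<in> topspace state_space" "\<tau> \<in> topspace state_space" "0 \<le> l" "l \<le> 1"
  show "\<exists>\<rho>\<in>topspace state_space. \<forall>f\<in>range (\<lambda>a \<phi>. Re (\<phi> a)). \<forall>i.
      f (((\<lambda>\<sigma>. \<sigma> \<circ> \<alpha>) ^^ i) \<rho>) =
      (1 - l) * f (((\<lambda>\<sigma>. \<sigma> \<circ> \<alpha>) ^^ i) \<sigma>) + l * f (((\<lambda>\<sigma>. \<sigma> \<circ> \<alpha>) ^^ i) \<tau>)"
    \<comment> \<open>The iterates precompose with powers of \<alpha>, so an observable at time
      \<open>i\<close> evaluates the state at \<open>(\<alpha> ^^ i) a\<close>; the pointwise convex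
      combination therefore interpolates at all times at once.\<close>
    using states_convex[of \<sigma> \<tau> l] *
    by (intro bexI[of _ "\<lambda>x. of_real (1 - l) * \<sigma> x + of_real l * \<tau> x"])
      (auto simp: funpow_comp_right topspace_state_space)
qed

theorem proposition2p1:
  fixes \<alpha> :: "'a::cstar_algebra_1 \<Rightarrow> 'a"
  assumes "separable_space (euclidean :: 'a topology)"
    and "cstar_automorphism \<alpha>"
  shows "topological_entropy (state_space :: ('a \<Rightarrow> complex) topology) (\<lambda>\<sigma>. \<sigma> \<circ> \<alpha>) = 0 \<or>
         topological_entropy (state_space :: ('a \<Rightarrow> complex) topology) (\<lambda>\<sigma>. \<sigma> \<circ> \<alpha>) = \<infinity>"
  by (rule affine_observables.topological_entropy_0_or_infinity[OF
        affine_observables_state_space[OF assms(2)]])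

end
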